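(* Let $\mathfrak{G} = (G; +, <, \dots)$ be an expansion of a divisible ordered abelian group whose theory is dp-minimal. Then for each $n\ge 1$: (1) if $X\subseteq G^n$ is a definable set with non-empty interior and $X = X_1\cup\dots\cup X_r$ is a partition of $X$ into definable sets, then some $X_i$ has non-empty interior; (2) if $f: G^n\to\overline{G}_+$ is a definable function, then for every open box $B\subseteq G^n$ there exist an open box $B'\subseteq B$ and $\epsilon>0$ such that $f(x)>\epsilon$ for all $x\in B'$.
   Context: Topology on $G^n$ is the product of the order topology; an open box is a product of $n$ open intervals. $\overline{G}$ denotes the completion of $G$ with respect to the order and $\overline{G}_+$ its positive elements; a function $f:G^n\to\overline{G}$ is definable if $\{(a,c)\in G^{n}\times G: c<f(a)\}$ is definable in $\mathfrak{G}$. A complete theory with monster model $\mathcal{U}$ is dp-minimal if there do not exist formulas $\varphi(x;y)$, $\psi(x;z)$ with $x$ a single variable, $a_i\in\mathcal{U}_y$, $b_j\in\mathcal{U}_z$ ($i,j<\omega$) such that for all $i_0,j_0<\omega$ the set $\{\varphi(x;a_{i_0}),\psi(x;b_{j_0})\}\cup\{\neg\varphi(x;a_i): i\ne i_0\}\cup\{\neg\psi(x;b_j): j\ne j_0\}$ is consistent. *)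

theory Defs
  imports Main
begin

datatype 'f trm = Var nat | Fun 'f "'f trm list"

datatype ('f, 'r) fm =
    Eq "'f trm" "'f trm"
  | Rel 'r "'f trm list"
  | Neg "('f, 'r) fm"
  | Conj "('f, 'r) fm" "('f, 'r) fm"
  | Ex nat "('f, 'r) fm"

type_synonym ('a, 'f, 'r) struct = "('f \<Rightarrow> 'a list \<Rightarrow> 'a) \<times> ('r \<Rightarrow> 'a list \<Rightarrow> bool)"

primrec eval :: "('f \<Rightarrow> 'a list \<Rightarrow> 'a) \<Rightarrow> (nat \<Rightarrow> 'a) \<Rightarrow> 'f trm \<Rightarrow> 'a" where
  "eval F s (Var v) = s v"
| "eval F s (Fun f ts) = F f (map (eval F s) ts)"

primrec sat :: "('a, 'f, 'r) struct \<Rightarrow> (nat \<Rightarrow> 'a) \<Rightarrow> ('f, 'r) fm \<Rightarrow> bool" where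
  "sat M s (Eq t u) = (eval (fst M) s t = eval (fst M) s u)"
| "sat M s (Rel r ts) = snd M r (map (eval (fst M) s) ts)"
| "sat M s (Neg \<phi>) = (\<not> sat M s \<phi>)"
| "sat M s (Conj \<phi> \<psi>) = (sat M s \<phi> \<and> sat M s \<psi>)"
| "sat M s (Ex v \<phi>) = (\<exists>a. sat M (s(v := a)) \<phi>)"

definition elem_emb :: "('a, 'f, 'r) struct \<Rightarrow> ('b, 'f, 'r) struct \<Rightarrow> ('a \<Rightarrow> 'b) \<Rightarrow> bool" where
  "elem_emb M N h \<longleftrightarrow> (\<forall>\<phi> s. sat M s \<phi> \<longleftrightarrow> sat N (h \<circ> s) \<phi>)"

text \<open>dp-minimality of Th(M).  The monster model is replaced by an arbitrary
  elementary extension of M whose universe is the type 'a + ('f,'r) fm, which has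
  cardinality |M| + |L| + aleph_0 (enough by downward Loewenheim-Skolem).
  A formula phi(x;y) is a formula in which variable 0 plays the role of x; a
  parameter tuple is an assignment of the remaining variables.  Consistency of a
  partial type over the model means finite satisfiability in it.\<close>
definition dp_minimal :: "('a, 'f, 'r) struct \<Rightarrow> bool" where
  "dp_minimal M \<longleftrightarrow> \<not> (\<exists>(N :: ('a + ('f, 'r) fm, 'f, 'r) struct) h
      (\<phi> :: ('f, 'r) fm) (\<psi> :: ('f, 'r) fm)
      (a :: nat \<Rightarrow> nat \<Rightarrow> 'a + ('f, 'r) fm) (b :: nat \<Rightarrow> nat \<Rightarrow> 'a + ('f, 'r) fm).
      elem_emb M N h \<and>
      (\<forall>i0 j0 I J. finite I \<longrightarrow> finite J \<longrightarrow>
         (\<exists>x. sat N ((a i0)(0 := x)) \<phi> \<and> sat N ((b j0)(0 := x)) \<psi> \<and>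
              (\<forall>i\<in>I - {i0}. \<not> sat N ((a i)(0 := x)) \<phi>) \<and>
              (\<forall>j\<in>J - {j0}. \<not> sat N ((b j)(0 := x)) \<psi>))))"

definition definable :: "('a, 'f, 'r) struct \<Rightarrow> nat \<Rightarrow> 'a list set \<Rightarrow> bool" where
  "definable M n X \<longleftrightarrow> (\<exists>\<phi> s. X = {xs. length xs = n \<and>
      sat M (\<lambda>v. if v < n then xs ! v else s v) \<phi>})"

definition open_box :: "nat \<Rightarrow> ('a::linorder) list set \<Rightarrow> bool" where
  "open_box n B \<longleftrightarrow> (\<exists>lo hi. length lo = n \<and> length hi = n \<and> (\<forall>i<n. lo ! i < hi ! i) \<and>
      B = {x. length x = n \<and> (\<forall>i<n. lo ! i < x ! i \<and> x ! i < hi ! i)})"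

text \<open>Non-empty interior in the product of the order topology on G^n
  (G dense without endpoints): contains an open box.\<close>
definition nonempty_interior :: "nat \<Rightarrow> ('a::linorder) list set \<Rightarrow> bool" where
  "nonempty_interior n X \<longleftrightarrow> (\<exists>B. open_box n B \<and> B \<subseteq> X)"

text \<open>Elements of the Dedekind completion of G are represented by their lower
  cuts L = {c in G. c < g}: nonempty, downward closed, without maximum
  (L = UNIV represents +infinity).  g > 0 iff 0 in L.\<close>
definition pos_cut :: "('a::linordered_ab_group_add) set \<Rightarrow> bool" where
  "pos_cut L \<longleftrightarrow> (\<forall>c\<in>L. \<forall>d. d \<le> c \<longrightarrow> d \<in> L) \<and> (\<forall>c\<in>L. \<exists>d\<in>L. c < d) \<and> 0 \<in> L"

text \<open>A function f : G^n -> completion, given by f xs = {c. c < f(xs)}, is definable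
  if {(xs,c). c < f(xs)} is definable.\<close>
definition definable_fun :: "('a, 'f, 'r) struct \<Rightarrow> nat \<Rightarrow> ('a list \<Rightarrow> 'a set) \<Rightarrow> bool" where
  "definable_fun M n f \<longleftrightarrow> definable M (Suc n) {xs @ [c] | xs c. length xs = n \<and> c \<in> f xs}"

end

theory Submission
  imports Defs "HOL-Library.Nat_Bijection"
begin

text \<open>By an ultrapower and a Skolem hull, dp-minimality bounds the size of the finite patterns
  in which a family of disjoint intervals is crossed with exclusive instances of a second formula.
  Three consequences drive the proof. A definable subset of \<open>G\<close> has finitely many punctured germs
  \<open>X - a\<close> at 0, since otherwise differences of translates would be exclusive in a sequence of shells
  around 0. A positive definable function is bounded below on a small interval, since otherwise
  the conditions \<open>\<epsilon>' < f \<le> \<epsilon>\<close> would be exclusive. Hence, if a germ class of \<open>X\<close> is dense near \<open>p\<close>,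
  the germs agree on a common neighbourhood, and the class minus \<open>p\<close> is a local subgroup with
  finitely many germs, so of finite index; by divisibility it is everything, and \<open>X\<close> is locally
  constant near \<open>p\<close>. Both statements in dimension \<open>n + 1\<close> follow from those in dimension \<open>n\<close> by
  exhibiting a pattern in a single fibre.\<close>

text \<open>\<open>dp_minimal\<close> fixes the universe of the elementary extension to one type, so
  compactness has to deliver a model of exactly that cardinality; this is why only a hull inside an
  ultrapower is formed. Parameters stay free in all formulas, so the bound on the size of patterns
  depends on two formulas only and is uniform in points, radii and boxes. The two statements are
  entangled: partitions in dimension n + 1 use both statements in dimension n, and bounds in
  dimension n + 1 use partitions in the same dimension. The knot is opened in dimension one: the
  base of a fibre is then a single point, so failure of a bound at one point already fills a whole
  (zero-dimensional) box and no partition result is called for. The bound thus obtained in dimension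
  one supplies the common radius of agreement of germs on which the partition result for intervals
  rests.\<close>

unbundle cardinal_syntax

section \<open>Elementary extensions of prescribed cardinality\<close>

lemma finite_support_map_eval:
  fixes ts :: "'f trm list"
  assumes "\<forall>t\<in>set ts. \<exists>n. \<forall>(F :: 'f \<Rightarrow> 'a list \<Rightarrow> 'a) s s'.
    (\<forall>v<n. s v = s' v) \<longrightarrow> eval F s t = eval F s' t"
  shows "\<exists>n. \<forall>(F :: 'f \<Rightarrow> 'a list \<Rightarrow> 'a) s s'.
    (\<forall>v<n. s v = s' v) \<longrightarrow> map (eval F s) ts = map (eval F s') ts"
  using assms
proof (induction ts)
  case (Cons t ts)
  from Cons.prems obtain m where m: "\<And>(F :: 'f \<Rightarrow> 'a list \<Rightarrow> 'a) s s'. \<forall>v<m. s v = s' v \<Longrightarrow> eval F s t = eval F s' t"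
    by (metis list.set_intros(1))
  from Cons obtain n where n: "\<And>(F :: 'f \<Rightarrow> 'a list \<Rightarrow> 'a) s s'. \<forall>v<n. s v = s' v \<Longrightarrow> map (eval F s) ts = map (eval F s') ts"
    by (metis list.set_intros(2))
  show ?case
  proof (intro exI[of _ "max m n"] allI impI)
    fix F :: "'f \<Rightarrow> 'a list \<Rightarrow> 'a" and s s' :: "nat \<Rightarrow> 'a"
    assume "\<forall>v<max m n. s v = s' v"
    then show "map (eval F s) (t # ts) = map (eval F s') (t # ts)"
      using m[of s s' F] n[of s s' F] by simp
  qed
qed simp

lemma eval_finite_support:
  fixes t :: "'f trm"
  shows "\<exists>n. \<forall>(F :: 'f \<Rightarrow> 'a list \<Rightarrow> 'a) s s'. (\<forall>v<n. s v = s' v) \<longrightarrow> eval F s t = eval F s' t"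
proof (induction t)
  case (Var v)
  show ?case by (rule exI[of _ "Suc v"]) simp
next
  case (Fun f ts)
  have "\<exists>n. \<forall>(F :: 'f \<Rightarrow> 'a list \<Rightarrow> 'a) s s'. (\<forall>v<n. s v = s' v)
      \<longrightarrow> map (eval F s) ts = map (eval F s') ts"
    by (rule finite_support_map_eval) (rule ballI, rule Fun)
  then obtain n where n: "\<forall>(F :: 'f \<Rightarrow> 'a list \<Rightarrow> 'a) s s'. (\<forall>v<n. s v = s' v)
      \<longrightarrow> map (eval F s) ts = map (eval F s') ts" by blast
  have "eval F s (Fun f ts) = eval F s' (Fun f ts)" if "\<forall>v<n. s v = s' v"
    for F :: "'f \<Rightarrow> 'a list \<Rightarrow> 'a" and s s'
  proof -
    have "map (eval F s) ts = map (eval F s') ts" by (rule n[rule_format]) (erule that[rule_format])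
    then show ?thesis by (simp only: eval.simps)
  qed
  then show ?case by blast
qed

text \<open>A semantic substitute for the finiteness of the set of free variables. It turns eventual
  equality in each coordinate into eventual equality of truth values, and it supplies fresh
  variables for \<open>sat_rename\<close>.\<close>

lemma sat_finite_support:
  fixes \<phi> :: "('f, 'r) fm"
  shows "\<exists>n. \<forall>(M :: ('a, 'f, 'r) struct) s s'. (\<forall>v<n. s v = s' v) \<longrightarrow> sat M s \<phi> = sat M s' \<phi>"
proof (induction \<phi>)
  case (Eq t u)
  have "\<exists>n. \<forall>(F :: 'f \<Rightarrow> 'a list \<Rightarrow> 'a) s s'. (\<forall>v<n. s v = s' v)
      \<longrightarrow> map (eval F s) [t, u] = map (eval F s') [t, u]"
    by (rule finite_support_map_eval) (rule ballI, rule eval_finite_support)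
  then obtain n where n: "\<forall>(F :: 'f \<Rightarrow> 'a list \<Rightarrow> 'a) s s'. (\<forall>v<n. s v = s' v)
      \<longrightarrow> map (eval F s) [t, u] = map (eval F s') [t, u]" by blast
  have "sat M s (Eq t u) = sat M s' (Eq t u)" if "\<forall>v<n. s v = s' v"
    for M :: "('a, 'f, 'r) struct" and s s'
  proof -
    have "map (eval (fst M) s) [t, u] = map (eval (fst M) s') [t, u]" by (rule n[rule_format]) (erule that[rule_format])
    then show ?thesis by (simp only: sat.simps list.map list.inject)
  qed
  then show ?case by blast
next
  case (Rel r ts)
  have "\<exists>n. \<forall>(F :: 'f \<Rightarrow> 'a list \<Rightarrow> 'a) s s'. (\<forall>v<n. s v = s' v)
      \<longrightarrow> map (eval F s) ts = map (eval F s') ts"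
    by (rule finite_support_map_eval) (rule ballI, rule eval_finite_support)
  then obtain n where n: "\<forall>(F :: 'f \<Rightarrow> 'a list \<Rightarrow> 'a) s s'. (\<forall>v<n. s v = s' v)
      \<longrightarrow> map (eval F s) ts = map (eval F s') ts" by blast
  have "sat M s (Rel r ts) = sat M s' (Rel r ts)" if "\<forall>v<n. s v = s' v"
    for M :: "('a, 'f, 'r) struct" and s s'
  proof -
    have "map (eval (fst M) s) ts = map (eval (fst M) s') ts" by (rule n[rule_format]) (erule that[rule_format])
    then show ?thesis by (simp only: sat.simps)
  qed
  then show ?case by blast
next
  case (Neg \<phi>)
  then show ?case by (simp only: sat.simps) blast
next
  case (Conj \<phi> \<psi>)
  then obtain n m where nm: "\<forall>(M :: ('a, 'f, 'r) struct) s s'. (\<forall>v<n. s v = s' v) \<longrightarrow> sat M s \<phi> = sat M s' \<phi>"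
    "\<forall>(M :: ('a, 'f, 'r) struct) s s'. (\<forall>v<m. s v = s' v) \<longrightarrow> sat M s \<psi> = sat M s' \<psi>" by blast
  have "sat M s (Conj \<phi> \<psi>) = sat M s' (Conj \<phi> \<psi>)" if "\<forall>v<max n m. s v = s' v"
    for M :: "('a, 'f, 'r) struct" and s s'
    using nm(1)[rule_format, of s s' M] nm(2)[rule_format, of s s' M] that by simp
  then show ?case by blast
next
  case (Ex v \<phi>)
  then obtain n where n: "\<forall>(M :: ('a, 'f, 'r) struct) s s'. (\<forall>v<n. s v = s' v) \<longrightarrow> sat M s \<phi> = sat M s' \<phi>" by blast
  have "sat M s (Ex v \<phi>) = sat M s' (Ex v \<phi>)" if "\<forall>u<n. s u = s' u"
    for M :: "('a, 'f, 'r) struct" and s s'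
  proof -
    have "sat M (s(v := a)) \<phi> = sat M (s'(v := a)) \<phi>" for a
      by (rule n[rule_format]) (simp add: that)
    then show ?thesis by simp
  qed
  then show ?case by blast
qed

section \<open>Ultrafilters, Skolem hulls and small ultrapowers\<close>

text \<open>Ultrafilters are the minimal proper filters, so Zorn is applied to the reversed order.
  The infimum of a chain stays proper because what holds eventually in it does so already in a
  member. Minimality decides \<open>P\<close>, since cutting \<open>U\<close> down to
  \<open>P\<close> gives \<open>bot\<close> or changes nothing.\<close>

lemma ultrafilter_exists:
  assumes "F \<noteq> bot"
  shows "\<exists>U\<le>F. U \<noteq> bot \<and> (\<forall>P. eventually P U \<or> eventually (\<lambda>x. \<not> P x) U)"
proof -
  let ?A = "{U. U \<le> F \<and> U \<noteq> bot}"
  have "\<exists>m\<in>?A. \<forall>a\<in>?A. a \<le> m \<longrightarrow> a = m"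
  proof (rule predicate_Zorn)
    show "partial_order_on ?A (relation_of (\<lambda>x y. y \<le> x) ?A)"
      by (rule partial_order_on_relation_ofI) auto
    fix C assume C: "C \<in> Chains (relation_of (\<lambda>x y. y \<le> x) ?A)"
    then have sub: "C \<subseteq> ?A" and tot: "\<And>x y. x \<in> C \<Longrightarrow> y \<in> C \<Longrightarrow> x \<le> y \<or> y \<le> x"
      unfolding Chains_def relation_of_def by auto
    show "\<exists>u\<in>?A. \<forall>a\<in>C. u \<le> a"
    proof (cases "C = {}")
      case True
      then show ?thesis using assms by auto
    next
      case False
      have "eventually P (Inf C) \<longleftrightarrow> (\<exists>b\<in>C. eventually P b)" for P
      proof (rule eventually_Inf_base[OF False])
        fix G H assume "G \<in> C" "H \<in> C"
        then show "\<exists>x\<in>C. x \<le> inf G H" using tot[of G H] by auto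
      qed
      then have "Inf C \<noteq> bot" using sub by (auto simp: trivial_limit_def)
      moreover from False obtain c where "c \<in> C" by blast
      then have "Inf C \<le> F" using sub by (intro Inf_lower2[of c]) auto
      ultimately show ?thesis by (auto intro: Inf_lower)
    qed
  qed
  then obtain U where U: "U \<le> F" "U \<noteq> bot" and max: "\<And>V. V \<le> F \<Longrightarrow> V \<noteq> bot \<Longrightarrow> V \<le> U \<Longrightarrow> V = U"
    by auto
  have "eventually P U" if "\<not> eventually (\<lambda>x. \<not> P x) U" for P
  proof -
    have "inf U (principal {x. P x}) \<noteq> bot"
      using that by (auto simp: trivial_limit_def eventually_inf_principal)
    then have "inf U (principal {x. P x}) = U"
      using max[of "inf U (principal {x. P x})"] U(1) by (simp add: le_infI1)
    moreover have "eventually P (inf U (principal {x. P x}))"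
      by (simp add: eventually_inf_principal)
    ultimately show ?thesis by simp
  qed
  with U show ?thesis by blast
qed

lemma card_of_Times_le:
  assumes "infinite (UNIV :: 'k set)" and "|A| \<le>o |UNIV :: 'k set|" and "|B| \<le>o |UNIV :: 'k set|"
  shows "|A \<times> B| \<le>o |UNIV :: 'k set|"
  by (rule card_of_Times_ordLeq_infinite_Field[OF _ assms(2,3) card_of_Card_order]) (simp add: Field_card_of assms(1))

lemma card_of_Un_le:
  assumes "infinite (UNIV :: 'k set)" and "|A| \<le>o |UNIV :: 'k set|" and "|B| \<le>o |UNIV :: 'k set|"
  shows "|A \<union> B| \<le>o |UNIV :: 'k set|"
  by (rule card_of_Un_ordLeq_infinite_Field[OF _ assms(2,3) card_of_Card_order]) (simp add: Field_card_of assms(1))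

lemma card_of_lists_le:
  assumes inf: "infinite (UNIV :: 'k set)" and A: "|A| \<le>o |UNIV :: 'k set|"
  shows "|lists A| \<le>o |UNIV :: 'k set|"
proof -
  have "|{xs \<in> lists A. length xs = n}| \<le>o |UNIV :: 'k set|" for n
  proof (induction n)
    case 0
    have "{xs \<in> lists A. length xs = 0} = {[]}" by auto
    then show ?case using inf by (simp add: card_of_singl_ordLeq)
  next
    case (Suc n)
    let ?L = "{xs \<in> lists A. length xs = n}"
    have "{xs \<in> lists A. length xs = Suc n} \<subseteq> (\<lambda>(x, xs). x # xs) ` (A \<times> ?L)"
      by (auto simp: length_Suc_conv image_iff)
    then have "|{xs \<in> lists A. length xs = Suc n}| \<le>o |A \<times> ?L|" by (rule surj_imp_ordLeq)
    moreover have "|A \<times> ?L| \<le>o |UNIV :: 'k set|"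
      by (rule card_of_Times_le[OF inf A Suc])
    ultimately show ?case by (rule ordLeq_transitive)
  qed
  moreover have "lists A = (\<Union>n. {xs \<in> lists A. length xs = n})" by auto
  ultimately show ?thesis
    using card_of_UNION_ordLeq_infinite[OF inf, of "UNIV :: nat set" "\<lambda>n. {xs \<in> lists A. length xs = n}"]
      inf[unfolded infinite_iff_card_of_nat] by simp
qed

text \<open>Countably many closure steps suffice, because a finite argument list already lies in one
  stage. \<open>w\<close> accepts lists of every length, so a single family covers Skolem functions
  of all arities.\<close>

lemma closed_hull_card:
  fixes w :: "'c \<Rightarrow> 'x list \<Rightarrow> 'x"
  assumes inf: "infinite (UNIV :: 'k set)" and H0: "|H0| \<le>o |UNIV :: 'k set|"
    and C: "|UNIV :: 'c set| \<le>o |UNIV :: 'k set|"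
  shows "\<exists>H. H0 \<subseteq> H \<and> |H| \<le>o |UNIV :: 'k set| \<and> (\<forall>c ts. set ts \<subseteq> H \<longrightarrow> w c ts \<in> H)"
proof -
  define step where "step S = S \<union> case_prod w ` (UNIV \<times> lists S)" for S
  define H where "H n = (step ^^ n) H0" for n
  have H_Suc: "H (Suc n) = step (H n)" for n by (simp add: H_def)
  have "mono H"
    by (rule monoI, rule lift_Suc_mono_le[of H]) (auto simp: H_Suc step_def)
  have card: "|H n| \<le>o |UNIV :: 'k set|" for n
  proof (induction n)
    case 0
    then show ?case using H0 by (simp add: H_def)
  next
    case (Suc n)
    have "|(UNIV :: 'c set) \<times> lists (H n)| \<le>o |UNIV :: 'k set|"
      by (rule card_of_Times_le[OF inf C card_of_lists_le[OF inf Suc]])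
    then have "|case_prod w ` (UNIV \<times> lists (H n))| \<le>o |UNIV :: 'k set|"
      using card_of_image ordLeq_transitive by blast
    then show ?case unfolding H_Suc step_def by (rule card_of_Un_le[OF inf Suc])
  qed
  have "w c ts \<in> (\<Union>n. H n)" if ts: "set ts \<subseteq> (\<Union>n. H n)" for c ts
  proof -
    have "\<exists>n. set ts \<subseteq> H n" using ts
    proof (induction ts)
      case (Cons t ts)
      then obtain m n where "t \<in> H m" "set ts \<subseteq> H n" by auto
      moreover have "H m \<subseteq> H (max m n)" "H n \<subseteq> H (max m n)" using monoD[OF \<open>mono H\<close>] by simp_all
      ultimately show ?case by (intro exI[of _ "max m n"]) auto
    qed simp
    then obtain n where "set ts \<subseteq> H n" by blast
    then have "(c, ts) \<in> UNIV \<times> lists (H n)" by auto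
    then have "w c ts \<in> H (Suc n)" unfolding H_Suc step_def by (auto simp: image_iff)
    then show ?thesis by blast
  qed
  moreover have "H0 \<subseteq> (\<Union>n. H n)" using H_def[of 0] by auto
  moreover have "|\<Union>n. H n| \<le>o |UNIV :: 'k set|"
    using card_of_UNION_ordLeq_infinite[OF inf, of "UNIV :: nat set" H]
      inf[unfolded infinite_iff_card_of_nat] card by simp
  ultimately show ?thesis by blast
qed

text \<open>Los's argument only asks for witnesses of existential formulas, so a family closed under
  pointwise Skolem functions can replace the full power. The closure of \<open>H0\<close> has at
  most as many classes as \<open>'k\<close> has elements, and \<open>g\<close> provides at least as
  many; hence \<open>'k\<close> itself can be the universe, with \<open>\<beta>\<close> choosing
  representatives.\<close>

lemma small_ultrapower:
  fixes M :: "('a, 'f, 'r) struct" and U :: "'i filter" and H0 :: "('i \<Rightarrow> 'a) set" and g :: "'k \<Rightarrow> 'i \<Rightarrow> 'a"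
  assumes inf: "infinite (UNIV :: 'k set)" and fm: "|UNIV :: ('f, 'r) fm set| \<le>o |UNIV :: 'k set|"
    and H0: "|H0| \<le>o |UNIV :: 'k set|" and g: "range g \<subseteq> H0"
    and g_inj: "\<And>k l. k \<noteq> l \<Longrightarrow> \<forall>\<^sub>F i in U. g k i \<noteq> g l i"
    and U: "U \<noteq> bot" and ultra: "\<And>P. eventually P U \<or> eventually (\<lambda>i. \<not> P i) U"
  shows "\<exists>(N :: ('k, 'f, 'r) struct) \<beta>. (\<forall>x\<in>H0. \<exists>k. \<forall>\<^sub>F i in U. \<beta> k i = x i) \<and>
    (\<forall>\<phi> s. sat N s \<phi> \<longleftrightarrow> (\<forall>\<^sub>F i in U. sat M (\<lambda>v. \<beta> (s v) i) \<phi>))"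
proof -
  \<comment> \<open>\<open>c\<close> names a formula and the variable to be witnessed,
    \<open>ts\<close> lists the parameters. Variables beyond the list get \<open>undefined\<close>,
    which is harmless once the list covers the variables that matter.\<close>
  define w :: "('f, 'r) fm \<times> nat \<Rightarrow> ('i \<Rightarrow> 'a) list \<Rightarrow> 'i \<Rightarrow> 'a" where
    "w c ts i = (SOME y. sat M ((\<lambda>u. if u < length ts then (ts ! u) i else undefined)(snd c := y)) (fst c))"
    for c ts i
  have "|UNIV :: (('f, 'r) fm \<times> nat) set| \<le>o |UNIV :: 'k set|"
    unfolding UNIV_Times_UNIV[symmetric]
    by (rule card_of_Times_le[OF inf fm inf[unfolded infinite_iff_card_of_nat]])
  from closed_hull_card[OF inf H0 this, of w] obtain H where H: "H0 \<subseteq> H" "|H| \<le>o |UNIV :: 'k set|"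
    "\<And>c ts. set ts \<subseteq> H \<Longrightarrow> w c ts \<in> H" by blast
  define \<rho> where "\<rho> x = (SOME y. y \<in> H \<and> (\<forall>\<^sub>F i in U. y i = x i))" for x
  have \<rho>: "\<rho> x \<in> H \<and> (\<forall>\<^sub>F i in U. \<rho> x i = x i)" if "x \<in> H" for x
    unfolding \<rho>_def by (rule someI[of _ x]) (simp add: that)
  have \<rho>_cong: "\<rho> x = \<rho> y" if "\<forall>\<^sub>F i in U. x i = y i" for x y
  proof -
    have "(\<forall>\<^sub>F i in U. z i = x i) = (\<forall>\<^sub>F i in U. z i = y i)" for z
      by (rule eventually_cong[OF that]) simp
    then show ?thesis by (simp add: \<rho>_def)
  qed
  have "|\<rho> ` H| \<le>o |UNIV :: 'k set|" using card_of_image H(2) ordLeq_transitive by blast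
  moreover have "|UNIV :: 'k set| \<le>o |\<rho> ` H|"
  proof (rule card_of_ordLeqI[of "\<lambda>k. \<rho> (g k)"])
    show "inj (\<lambda>k. \<rho> (g k))"
    proof (rule injI, rule ccontr)
      fix k l assume eq: "\<rho> (g k) = \<rho> (g l)" and "k \<noteq> l"
      have "g k \<in> H" "g l \<in> H" using g H(1) by auto
      then have "\<forall>\<^sub>F i in U. \<rho> (g l) i = g k i" "\<forall>\<^sub>F i in U. \<rho> (g l) i = g l i"
        using \<rho>[of "g k"] \<rho>[of "g l"] eq by auto
      with g_inj[OF \<open>k \<noteq> l\<close>] have "\<forall>\<^sub>F i in U. False" by eventually_elim auto
      then show False using U by (simp add: trivial_limit_def)
    qed
    show "\<rho> (g k) \<in> \<rho> ` H" for k using g H(1) by auto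
  qed
  ultimately have "|UNIV :: 'k set| =o |\<rho> ` H|" unfolding ordIso_iff_ordLeq by blast
  then obtain \<beta> where \<beta>: "bij_betw \<beta> (UNIV :: 'k set) (\<rho> ` H)" unfolding card_of_ordIso[symmetric] by blast
  have \<beta>_range: "range \<beta> = \<rho> ` H" using \<beta> by (rule bij_betw_imp_surj_on)
  have \<beta>_rep: "\<exists>x\<in>H. \<beta> k = \<rho> x" for k using \<beta>_range by blast
  have \<beta>_H: "\<beta> k \<in> H" for k
  proof -
    obtain x where "x \<in> H" "\<beta> k = \<rho> x" using \<beta>_rep[of k] by blast
    then show ?thesis using \<rho> by simp
  qed
  have rep: "\<exists>k. \<forall>\<^sub>F i in U. \<beta> k i = x i" if "x \<in> H" for x
  proof -
    have "\<rho> x \<in> range \<beta>" unfolding \<beta>_range using that by (rule imageI)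
    then obtain k where "\<rho> x = \<beta> k" by (rule imageE)
    then show ?thesis using \<rho>[OF that, THEN conjunct2] by auto
  qed
  have inj: "k = l" if "\<forall>\<^sub>F i in U. \<beta> k i = \<beta> l i" for k l
  proof -
    obtain x y where x: "\<beta> k = \<rho> x" "x \<in> H" and y: "\<beta> l = \<rho> y" "y \<in> H"
      using \<beta>_rep by blast
    from that \<rho>[OF x(2), THEN conjunct2] \<rho>[OF y(2), THEN conjunct2] have "\<forall>\<^sub>F i in U. x i = y i"
      unfolding x y by eventually_elim simp
    then have "\<beta> k = \<beta> l" unfolding x y by (rule \<rho>_cong)
    then show ?thesis using bij_betw_imp_inj_on[OF \<beta>] by (simp add: inj_eq)
  qed
  have witness: "\<exists>k. \<forall>\<^sub>F i in U. (\<exists>y. sat M ((\<lambda>u. \<beta> (s u) i)(v := y)) \<phi>) \<longrightarrow>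
      sat M ((\<lambda>u. \<beta> (s u) i)(v := \<beta> k i)) \<phi>" for \<phi> v s
  proof -
    obtain n where n: "\<forall>(M :: ('a, 'f, 'r) struct) s s'. (\<forall>v<n. s v = s' v) \<longrightarrow> sat M s \<phi> = sat M s' \<phi>"
      using sat_finite_support[of \<phi>] by blast
    let ?ts = "map (\<lambda>u. \<beta> (s u)) [0..<n]"
    have eq: "sat M ((\<lambda>u. if u < length ?ts then (?ts ! u) i else undefined)(v := y)) \<phi>
        = sat M ((\<lambda>u. \<beta> (s u) i)(v := y)) \<phi>" for i y
      by (rule n[rule_format]) simp
    have "w (\<phi>, v) ?ts \<in> H" by (rule H(3)) (use \<beta>_H in auto)
    then obtain k where k: "\<forall>\<^sub>F i in U. \<beta> k i = w (\<phi>, v) ?ts i" using rep by blast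
    have "(\<exists>y. sat M ((\<lambda>u. \<beta> (s u) i)(v := y)) \<phi>) \<longrightarrow>
      sat M ((\<lambda>u. \<beta> (s u) i)(v := w (\<phi>, v) ?ts i)) \<phi>" for i
      unfolding w_def eq fst_conv snd_conv
      using someI_ex[of "\<lambda>y. sat M ((\<lambda>u. \<beta> (s u) i)(v := y)) \<phi>"] by simp
    then show ?thesis by (intro exI[of _ k] eventually_mono[OF k]) simp
  qed
  \<comment> \<open>Function symbols need no closure of their own: the value is the witness of an
    equation with a fresh variable.\<close>
  have fun_closed: "\<exists>k. \<forall>\<^sub>F i in U. \<beta> k i = fst M f (map (\<lambda>k. \<beta> k i) ks)" for f ks
  proof -
    let ?n = "length ks"
    let ?s = "\<lambda>u. ks ! u"
    have *: "sat M ((\<lambda>u. \<beta> (?s u) i)(?n := y)) (Eq (Var ?n) (Fun f (map Var [0..<?n])))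
        \<longleftrightarrow> y = fst M f (map (\<lambda>k. \<beta> k i) ks)" for i y
    proof -
      have "map (eval (fst M) ((\<lambda>u. \<beta> (?s u) i)(?n := y))) (map Var [0..<?n]) = map (\<lambda>k. \<beta> k i) ks"
        by (rule nth_equalityI) simp_all
      then show ?thesis by simp
    qed
    show ?thesis using witness[of ?s ?n "Eq (Var ?n) (Fun f (map Var [0..<?n]))"] unfolding * by simp
  qed
  define N :: "('k, 'f, 'r) struct" where
    "N = (\<lambda>f ks. SOME k. \<forall>\<^sub>F i in U. \<beta> k i = fst M f (map (\<lambda>k. \<beta> k i) ks),
          \<lambda>r ks. \<forall>\<^sub>F i in U. snd M r (map (\<lambda>k. \<beta> k i) ks))"
  have N_fun: "\<forall>\<^sub>F i in U. \<beta> (fst N f ks) i = fst M f (map (\<lambda>k. \<beta> k i) ks)" for f ks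
    unfolding N_def fst_conv by (rule someI_ex) (rule fun_closed)
  have los_eval: "\<forall>\<^sub>F i in U. \<beta> (eval (fst N) s t) i = eval (fst M) (\<lambda>v. \<beta> (s v) i) t" for s t
  proof (induction t)
    case (Fun f ts)
    then have "\<forall>\<^sub>F i in U. \<forall>t\<in>set ts. \<beta> (eval (fst N) s t) i = eval (fst M) (\<lambda>v. \<beta> (s v) i) t"
      by (simp add: eventually_ball_finite)
    with N_fun[of f "map (eval (fst N) s) ts"] show ?case
      by eventually_elim (simp add: comp_def cong: map_cong)
  qed simp
  have los: "sat N s \<phi> \<longleftrightarrow> (\<forall>\<^sub>F i in U. sat M (\<lambda>v. \<beta> (s v) i) \<phi>)" for \<phi> s
  proof (induction \<phi> arbitrary: s)
    case (Eq t u)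
    have "sat N s (Eq t u) \<longleftrightarrow> (\<forall>\<^sub>F i in U. \<beta> (eval (fst N) s t) i = \<beta> (eval (fst N) s u) i)"
      using inj by auto
    also have "\<dots> \<longleftrightarrow> (\<forall>\<^sub>F i in U. eval (fst M) (\<lambda>v. \<beta> (s v) i) t = eval (fst M) (\<lambda>v. \<beta> (s v) i) u)"
      by (rule eventually_cong[OF eventually_conj[OF los_eval[of s t] los_eval[of s u]]]) auto
    finally show ?case by simp
  next
    case (Rel r ts)
    have ev: "\<forall>\<^sub>F i in U. \<forall>t\<in>set ts. \<beta> (eval (fst N) s t) i = eval (fst M) (\<lambda>v. \<beta> (s v) i) t"
      by (simp add: eventually_ball_finite los_eval)
    have "sat N s (Rel r ts) \<longleftrightarrow> (\<forall>\<^sub>F i in U. snd M r (map (\<lambda>t. \<beta> (eval (fst N) s t) i) ts))"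
      by (simp add: N_def comp_def)
    also have "\<dots> \<longleftrightarrow> (\<forall>\<^sub>F i in U. snd M r (map (eval (fst M) (\<lambda>v. \<beta> (s v) i)) ts))"
      by (rule eventually_cong[OF ev]) (simp cong: map_cong)
    finally show ?case by simp
  next
    case (Neg \<phi>)
    have "\<not> eventually P U \<longleftrightarrow> (\<forall>\<^sub>F i in U. \<not> P i)" for P
    proof
      assume *: "\<forall>\<^sub>F i in U. \<not> P i"
      show "\<not> eventually P U"
      proof
        assume "eventually P U"
        with * have "\<forall>\<^sub>F i in U. False" by eventually_elim simp
        then show False using U by (simp add: trivial_limit_def)
      qed
    qed (use ultra in blast)
    with Neg show ?case by simp
  next
    case (Conj \<phi> \<psi>)
    then show ?case by (simp add: eventually_conj_iff)
  next
    case (Ex v \<phi>)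
    have upd: "(\<lambda>u. \<beta> ((s(v := k)) u) i) = (\<lambda>u. \<beta> (s u) i)(v := \<beta> k i)" for k i by auto
    have "sat N s (Ex v \<phi>) \<longleftrightarrow> (\<exists>k. \<forall>\<^sub>F i in U. sat M ((\<lambda>u. \<beta> (s u) i)(v := \<beta> k i)) \<phi>)"
      by (simp only: sat.simps Ex upd)
    also have "\<dots> \<longleftrightarrow> (\<forall>\<^sub>F i in U. \<exists>y. sat M ((\<lambda>u. \<beta> (s u) i)(v := y)) \<phi>)"
    proof
      assume "\<forall>\<^sub>F i in U. \<exists>y. sat M ((\<lambda>u. \<beta> (s u) i)(v := y)) \<phi>"
      moreover obtain k where "\<forall>\<^sub>F i in U. (\<exists>y. sat M ((\<lambda>u. \<beta> (s u) i)(v := y)) \<phi>) \<longrightarrow>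
          sat M ((\<lambda>u. \<beta> (s u) i)(v := \<beta> k i)) \<phi>" using witness by blast
      ultimately show "\<exists>k. \<forall>\<^sub>F i in U. sat M ((\<lambda>u. \<beta> (s u) i)(v := \<beta> k i)) \<phi>"
        by (intro exI[of _ k]) (rule eventually_mp)
    qed (auto elim: eventually_mono)
    finally show ?case by simp
  qed
  have "\<exists>k. \<forall>\<^sub>F i in U. \<beta> k i = x i" if "x \<in> H0" for x using rep that H(1) by blast
  with los show ?thesis by blast
qed

section \<open>Compactness for finite patterns\<close>

text \<open>Along an ultrafilter on the finite subsets of the intended universe, the index
  \<open>I\<close> carries a pattern of size \<open>card I\<close>. Any fixed indices are eventually
  below that size, so the finite patterns assemble to an infinite one.\<close>

lemma patterns_imp_not_dp_minimal:
  fixes M :: "('a, 'f, 'r) struct"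
  assumes inf: "infinite (UNIV :: 'a set)"
    and pat: "\<And>k :: nat. \<exists>a b x. \<forall>i<k. \<forall>j<k. (\<forall>l<k. sat M ((a l)(0 := x i j)) \<phi> \<longleftrightarrow> l = i) \<and>
      (\<forall>l<k. sat M ((b l)(0 := x i j)) \<psi> \<longleftrightarrow> l = j)"
  shows "\<not> dp_minimal M"
proof -
  let ?K = "UNIV :: ('a + ('f, 'r) fm) set"
  have infK: "infinite ?K" using inf by (simp add: finite_Plus_UNIV_iff)
  let ?P = "\<lambda>(k :: nat) a b x. \<forall>i<k. \<forall>j<k. (\<forall>l<k. sat M ((a l)(0 := x i j)) \<phi> \<longleftrightarrow> l = i) \<and>
      (\<forall>l<k. sat M ((b l)(0 := x i j)) \<psi> \<longleftrightarrow> l = j)"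
  have "\<exists>a. \<forall>k. \<exists>b x. ?P k (a k) b x" by (rule choice) (use pat in blast)
  then obtain a where "\<forall>k. \<exists>b x. ?P k (a k) b x" ..
  then have "\<exists>b. \<forall>k. \<exists>x. ?P k (a k) (b k) x" by (rule choice)
  then obtain b where "\<forall>k. \<exists>x. ?P k (a k) (b k) x" ..
  then have "\<exists>x. \<forall>k. ?P k (a k) (b k) (x k)" by (rule choice)
  then obtain x where pat: "\<forall>k. ?P k (a k) (b k) (x k)" ..
  let ?F = "finite_subsets_at_top ?K"
  have "?F \<noteq> bot" by simp
  then obtain U where U: "U \<le> ?F" "U \<noteq> bot" "\<And>P. eventually P U \<or> eventually (\<lambda>x. \<not> P x) U"
    using ultrafilter_exists by blast
  have evF: "\<forall>\<^sub>F I in U. finite I \<and> S \<subseteq> I" if "finite S" for S :: "('a + ('f, 'r) fm) set"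
    by (rule filter_leD[OF U(1)]) (use that in \<open>auto simp: eventually_finite_subsets_at_top\<close>)
  have ev_card: "\<forall>\<^sub>F I in U. n < card I" for n
  proof -
    obtain S where "finite S" "card S = Suc n" "S \<subseteq> ?K" using infinite_arbitrarily_large[OF infK] by blast
    then show ?thesis using evF[OF \<open>finite S\<close>] by (auto elim!: eventually_mono dest: card_mono)
  qed
  have "\<exists>f :: 'a + ('f, 'r) fm \<Rightarrow> 'a. inj_on f I" if "finite I" for I
  proof -
    obtain S :: "'a set" where "finite S" "card S = card I" using infinite_arbitrarily_large[OF inf] by blast
    then show ?thesis using finite_same_card_bij[OF that] by (metis bij_betw_def)
  qed
  then obtain e :: "('a + ('f, 'r) fm) set \<Rightarrow> 'a + ('f, 'r) fm \<Rightarrow> 'a" where e: "\<And>I. finite I \<Longrightarrow> inj_on (e I) I"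
    by metis
  \<comment> \<open>Each finite \<open>I\<close> is injected into \<open>'a\<close>, and two given
    labels eventually both lie in \<open>I\<close>. So the \<open>g k\<close> represent as many
    classes as the intended universe has elements.\<close>
  define g where "g k I = e I k" for k I
  have g: "\<forall>\<^sub>F I in U. g k I \<noteq> g l I" if "k \<noteq> l" for k l
    using evF[of "{k, l}"] by (auto simp: g_def that elim!: eventually_mono dest!: e inj_onD)
  \<comment> \<open>The constants in \<open>C\<close> yield the embedding \<open>h\<close>;
    \<open>A\<close>, \<open>B\<close> and \<open>X\<close> hold the coordinates of the parameters
    and the points of the patterns, only countably many.\<close>
  define C where "C = range (\<lambda>y (I :: ('a + ('f, 'r) fm) set). y :: 'a)"
  define A where "A = range (\<lambda>(l, v) (I :: ('a + ('f, 'r) fm) set). a (card I) l v)"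
  define B where "B = range (\<lambda>(l, v) (I :: ('a + ('f, 'r) fm) set). b (card I) l v)"
  define X where "X = range (\<lambda>(i, j) (I :: ('a + ('f, 'r) fm) set). x (card I) i j)"
  define H0 where "H0 = range g \<union> C \<union> A \<union> B \<union> X"
  have "|UNIV :: (nat \<times> nat) set| \<le>o |?K|"
    unfolding UNIV_Times_UNIV[symmetric]
    by (intro card_of_Times_le infK infK[unfolded infinite_iff_card_of_nat])
  then have im: "|range h| \<le>o |?K|" for h :: "nat \<times> nat \<Rightarrow> ('a + ('f, 'r) fm) set \<Rightarrow> 'a"
    using card_of_image ordLeq_transitive by blast
  have Kl: "|UNIV :: 'a set| \<le>o |?K|" by (rule card_of_ordLeqI[of Inl]) auto
  have Kr: "|UNIV :: ('f, 'r) fm set| \<le>o |?K|" by (rule card_of_ordLeqI[of Inr]) auto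
  have "|H0| \<le>o |?K|"
  proof -
    have "|C| \<le>o |?K|" unfolding C_def by (rule ordLeq_transitive[OF card_of_image Kl])
    moreover have "|range g| \<le>o |?K|" by (rule card_of_image)
    moreover have "|A| \<le>o |?K|" "|B| \<le>o |?K|" "|X| \<le>o |?K|" unfolding A_def B_def X_def by (rule im)+
    ultimately show ?thesis unfolding H0_def by (simp add: card_of_Un_le[OF infK])
  qed
  moreover have "range g \<subseteq> H0" by (auto simp: H0_def)
  ultimately have "\<exists>(N :: ('a + ('f, 'r) fm, 'f, 'r) struct) \<beta>. (\<forall>x\<in>H0. \<exists>k. \<forall>\<^sub>F i in U. \<beta> k i = x i) \<and>
      (\<forall>\<phi> s. sat N s \<phi> \<longleftrightarrow> (\<forall>\<^sub>F i in U. sat M (\<lambda>v. \<beta> (s v) i) \<phi>))"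
    by (rule small_ultrapower[OF infK Kr _ _ g U(2,3)])
  then obtain N :: "('a + ('f, 'r) fm, 'f, 'r) struct" and \<beta> where
    N\<beta>: "(\<forall>x\<in>H0. \<exists>k. \<forall>\<^sub>F i in U. \<beta> k i = x i) \<and>
      (\<forall>\<phi> s. sat N s \<phi> \<longleftrightarrow> (\<forall>\<^sub>F i in U. sat M (\<lambda>v. \<beta> (s v) i) \<phi>))"
    by (elim exE)
  note rep = bspec[OF N\<beta>[THEN conjunct1]] and los = N\<beta>[THEN conjunct2, rule_format]
  have los': "sat N s \<phi> \<longleftrightarrow> (\<forall>\<^sub>F I in U. sat M (t I) \<phi>)" if ev: "\<And>v. \<forall>\<^sub>F I in U. \<beta> (s v) I = t I v" for \<phi> s t
  proof -
    obtain n where n: "\<forall>(M :: ('a, 'f, 'r) struct) s s'. (\<forall>v<n. s v = s' v) \<longrightarrow> sat M s \<phi> = sat M s' \<phi>"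
      using sat_finite_support[of \<phi>] by blast
    have "\<forall>\<^sub>F I in U. \<forall>v\<in>{..<n}. \<beta> (s v) I = t I v"
      by (rule eventually_ball_finite) (use ev in auto)
    then show ?thesis unfolding los
      by (rule eventually_cong) (rule n[rule_format], blast)
  qed
  have "\<exists>k. \<forall>\<^sub>F I in U. \<beta> k I = y" for y
    using rep[of "\<lambda>I. y"] by (simp add: H0_def C_def)
  then obtain h where h: "\<And>y. \<forall>\<^sub>F I in U. \<beta> (h y) I = y" by metis
  have "\<exists>k. \<forall>\<^sub>F I in U. \<beta> k I = a (card I) l v" for l v
  proof -
    have "(\<lambda>I. a (card I) l v) \<in> A" unfolding A_def by (rule range_eqI[of _ _ "(l, v)"]) simp
    then have "(\<lambda>I. a (card I) l v) \<in> H0" unfolding H0_def by blast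
    then show ?thesis by (rule rep)
  qed
  then obtain a' where a': "\<And>l v. \<forall>\<^sub>F I in U. \<beta> (a' l v) I = a (card I) l v" by metis
  have "\<exists>k. \<forall>\<^sub>F I in U. \<beta> k I = b (card I) l v" for l v
  proof -
    have "(\<lambda>I. b (card I) l v) \<in> B" unfolding B_def by (rule range_eqI[of _ _ "(l, v)"]) simp
    then have "(\<lambda>I. b (card I) l v) \<in> H0" unfolding H0_def by blast
    then show ?thesis by (rule rep)
  qed
  then obtain b' where b': "\<And>l v. \<forall>\<^sub>F I in U. \<beta> (b' l v) I = b (card I) l v" by metis
  have "\<exists>k. \<forall>\<^sub>F I in U. \<beta> k I = x (card I) l v" for l v
  proof -
    have "(\<lambda>I. x (card I) l v) \<in> X" unfolding X_def by (rule range_eqI[of _ _ "(l, v)"]) simp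
    then have "(\<lambda>I. x (card I) l v) \<in> H0" unfolding H0_def by blast
    then show ?thesis by (rule rep)
  qed
  then obtain x' where x': "\<And>l v. \<forall>\<^sub>F I in U. \<beta> (x' l v) I = x (card I) l v" by metis
  have "elem_emb M N h"
    unfolding elem_emb_def
  proof (intro allI)
    fix \<phi> s
    have "sat N (h \<circ> s) \<phi> \<longleftrightarrow> (\<forall>\<^sub>F I in U. sat M s \<phi>)" by (rule los') (simp add: h)
    then show "sat M s \<phi> \<longleftrightarrow> sat N (h \<circ> s) \<phi>" using U(2) by simp
  qed
  moreover have satA: "sat N ((a' l)(0 := x' i j)) \<phi> \<longleftrightarrow> l = i" and satB: "sat N ((b' l)(0 := x' i j)) \<psi> \<longleftrightarrow> l = j" for i j l
  proof -
    have "sat N ((a' l)(0 := x' i j)) \<phi> \<longleftrightarrow> (\<forall>\<^sub>F I in U. sat M ((a (card I) l)(0 := x (card I) i j)) \<phi>)"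
      by (rule los') (auto simp: a' x')
    also have "\<dots> \<longleftrightarrow> (\<forall>\<^sub>F I in U. l = i)"
      by (rule eventually_cong[OF ev_card[of "i + j + l"]]) (use pat in auto)
    finally show "sat N ((a' l)(0 := x' i j)) \<phi> \<longleftrightarrow> l = i" using U(2) by simp
    have "sat N ((b' l)(0 := x' i j)) \<psi> \<longleftrightarrow> (\<forall>\<^sub>F I in U. sat M ((b (card I) l)(0 := x (card I) i j)) \<psi>)"
      by (rule los') (auto simp: b' x')
    also have "\<dots> \<longleftrightarrow> (\<forall>\<^sub>F I in U. l = j)"
      by (rule eventually_cong[OF ev_card[of "i + j + l"]]) (use pat in auto)
    finally show "sat N ((b' l)(0 := x' i j)) \<psi> \<longleftrightarrow> l = j" using U(2) by simp
  qed
  ultimately show ?thesis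
    unfolding dp_minimal_def
    by (simp only: not_not, intro exI[of _ N] exI[of _ h] exI[of _ \<phi>] exI[of _ \<psi>] exI[of _ a'] exI[of _ b'] conjI allI impI)
      (blast, metis DiffE satA satB singletonI)
qed

section \<open>Definable predicates\<close>

text \<open>No parameters are built in: they are further coordinates of the assignment. A bound
  found for one formula is therefore uniform in all parameters.\<close>

definition definable_pred :: "('a, 'f, 'r) struct \<Rightarrow> ((nat \<Rightarrow> 'a) \<Rightarrow> bool) \<Rightarrow> bool" where
  "definable_pred M P \<longleftrightarrow> (\<exists>\<phi>. \<forall>s. sat M s \<phi> = P s)"

text \<open>Variable 0 is split off and the others are shifted down, as with de Bruijn indices. This
  matches the role of variable 0 in \<open>dp_minimal\<close> and lets quantifiers be introduced
  without choosing names.\<close>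

definition definable_rel :: "('a, 'f, 'r) struct \<Rightarrow> ((nat \<Rightarrow> 'a) \<Rightarrow> 'a \<Rightarrow> bool) \<Rightarrow> bool" where
  "definable_rel M F \<longleftrightarrow> definable_pred M (\<lambda>s. F (\<lambda>v. s (Suc v)) (s 0))"

definition definable_term :: "('a, 'f, 'r) struct \<Rightarrow> ((nat \<Rightarrow> 'a) \<Rightarrow> 'a) \<Rightarrow> bool" where
  "definable_term M t \<longleftrightarrow> definable_rel M (\<lambda>s a. a = t s)"

lemma definable_pred_finite_support:
  assumes "definable_pred M P"
  shows "\<exists>n. \<forall>s s'. (\<forall>v<n. s v = s' v) \<longrightarrow> P s = P s'"
proof -
  obtain \<phi> where \<phi>: "\<forall>s. sat M s \<phi> = P s" using assms by (auto simp: definable_pred_def)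
  obtain n where "\<forall>s s'. (\<forall>v<n. s v = s' v) \<longrightarrow> sat M s \<phi> = sat M s' \<phi>"
    using sat_finite_support[of \<phi>] by blast
  then show ?thesis unfolding \<phi>[rule_format] by blast
qed

lemma definable_pred_Not: "definable_pred M P \<Longrightarrow> definable_pred M (\<lambda>s. \<not> P s)"
  unfolding definable_pred_def by (metis sat.simps(3))

lemma definable_pred_conj: "definable_pred M P \<Longrightarrow> definable_pred M Q \<Longrightarrow> definable_pred M (\<lambda>s. P s \<and> Q s)"
  unfolding definable_pred_def by (metis sat.simps(4))

lemma definable_pred_disj: "definable_pred M P \<Longrightarrow> definable_pred M Q \<Longrightarrow> definable_pred M (\<lambda>s. P s \<or> Q s)"
  using definable_pred_Not[OF definable_pred_conj[OF definable_pred_Not definable_pred_Not], of M P Q] by simp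

lemma definable_pred_imp: "definable_pred M P \<Longrightarrow> definable_pred M Q \<Longrightarrow> definable_pred M (\<lambda>s. P s \<longrightarrow> Q s)"
  unfolding imp_conv_disj by (intro definable_pred_disj definable_pred_Not)

lemma definable_pred_iff: "definable_pred M P \<Longrightarrow> definable_pred M Q \<Longrightarrow> definable_pred M (\<lambda>s. P s \<longleftrightarrow> Q s)"
  unfolding iff_conv_conj_imp by (intro definable_pred_conj definable_pred_imp)

lemma definable_pred_Ex_update: "definable_pred M P \<Longrightarrow> definable_pred M (\<lambda>s. \<exists>a. P (s(v := a)))"
  unfolding definable_pred_def by (metis sat.simps(5))

primrec rename :: "(nat \<Rightarrow> nat) \<Rightarrow> 'f trm \<Rightarrow> 'f trm" where
  "rename \<rho> (Var v) = Var (\<rho> v)"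
| "rename \<rho> (Fun f ts) = Fun f (map (rename \<rho>) ts)"

lemma eval_rename: "eval F s (rename \<rho> t) = eval F (\<lambda>v. s (\<rho> v)) t"
  by (induction t) (simp_all add: comp_def cong: map_cong)

lemma sat_rename:
  fixes M :: "('a, 'f, 'r) struct"
  shows "\<exists>\<phi>'. \<forall>s. sat M s \<phi>' = sat M (\<lambda>v. s (\<rho> v)) \<phi>"
proof (induction \<phi> arbitrary: \<rho>)
  case (Eq t u)
  show ?case by (rule exI[of _ "Eq (rename \<rho> t) (rename \<rho> u)"]) (simp add: eval_rename)
next
  case (Rel r ts)
  show ?case by (rule exI[of _ "Rel r (map (rename \<rho>) ts)"]) (simp add: eval_rename comp_def)
next
  case (Neg \<phi>)
  from Neg[of \<rho>] obtain \<phi>' where "\<forall>s. sat M s \<phi>' = sat M (\<lambda>v. s (\<rho> v)) \<phi>" ..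
  then show ?case by (intro exI[of _ "Neg \<phi>'"]) simp
next
  case (Conj \<phi> \<psi>)
  from Conj(1)[of \<rho>] obtain \<phi>' where 1: "\<forall>s. sat M s \<phi>' = sat M (\<lambda>v. s (\<rho> v)) \<phi>" ..
  from Conj(2)[of \<rho>] obtain \<psi>' where 2: "\<forall>s. sat M s \<psi>' = sat M (\<lambda>v. s (\<rho> v)) \<psi>" ..
  from 1 2 show ?case by (intro exI[of _ "Conj \<phi>' \<psi>'"]) simp
next
  case (Ex v \<phi>)
  obtain n where n: "\<forall>(M :: ('a, 'f, 'r) struct) s s'. (\<forall>v<n. s v = s' v) \<longrightarrow> sat M s \<phi> = sat M s' \<phi>"
    using sat_finite_support[of \<phi>] by blast
  \<comment> \<open>\<open>\<rho>\<close> may identify variables. To avoid capture, the bound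
    variable is moved outside the image of those that matter.\<close>
  obtain w where w: "w \<notin> \<rho> ` {..<n}" using ex_new_if_finite[of "\<rho> ` {..<n}"] by auto
  from Ex[of "\<rho>(v := w)"] obtain \<phi>' where \<phi>': "\<forall>s. sat M s \<phi>' = sat M (\<lambda>u. s ((\<rho>(v := w)) u)) \<phi>" ..
  have "sat M s (Ex w \<phi>') = sat M (\<lambda>v. s (\<rho> v)) (Ex v \<phi>)" for s
  proof -
    have "sat M (s(w := a)) \<phi>' = sat M ((\<lambda>v. s (\<rho> v))(v := a)) \<phi>" for a
      unfolding \<phi>'[rule_format] by (rule n[rule_format]) (use w in auto)
    then show ?thesis by simp
  qed
  then show ?case by blast
qed

lemma definable_pred_rename:
  assumes "definable_pred M P"
  shows "definable_pred M (\<lambda>s. P (\<lambda>v. s (\<rho> v)))"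
proof -
  obtain \<phi> where "\<forall>s. sat M s \<phi> = P s" using assms by (auto simp: definable_pred_def)
  then show ?thesis unfolding definable_pred_def using sat_rename[of M \<rho> \<phi>] by simp
qed

lemma definable_pred_Ex:
  assumes "definable_pred M (\<lambda>s. F (\<lambda>v. s (Suc v)) (s 0))"
  shows "definable_pred M (\<lambda>s. \<exists>a. F s a)"
  \<comment> \<open>The predecessor map undoes the shift; its value at 0 is overwritten by the
    quantified element.\<close>
  using definable_pred_rename[OF definable_pred_Ex_update[OF assms, of 0], of "\<lambda>v. v - 1"] by simp

lemma definable_pred_All:
  assumes "definable_pred M (\<lambda>s. F (\<lambda>v. s (Suc v)) (s 0))"
  shows "definable_pred M (\<lambda>s. \<forall>a. F s a)"
  using definable_pred_Not[OF definable_pred_Ex[OF definable_pred_Not[OF assms]]] by simp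

lemma definable_pred_True: "definable_pred M (\<lambda>s. True)"
  unfolding definable_pred_def by (rule exI[of _ "Eq (Var 0) (Var 0)"]) simp

lemma definable_pred_all_less: "(\<And>i. i < (r :: nat) \<Longrightarrow> definable_pred M (P i)) \<Longrightarrow> definable_pred M (\<lambda>s. \<forall>i<r. P i s)"
proof (induction r)
  case 0
  then show ?case by (simp add: definable_pred_True)
next
  case (Suc r)
  have "definable_pred M (\<lambda>s. P r s \<and> (\<forall>i<r. P i s))" by (intro definable_pred_conj Suc) auto
  then show ?case by (simp add: All_less_Suc)
qed

lemma definable_term_rename: "definable_term M t \<Longrightarrow> definable_term M (\<lambda>s. t (\<lambda>v. s (\<rho> v)))"
  unfolding definable_term_def definable_rel_def
  by (drule definable_pred_rename[of M _ "case_nat 0 (\<lambda>v. Suc (\<rho> v))"]) simp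

text \<open>The variables are replaced one after the other; in the intermediate steps the even
  variables hold the arguments of \<open>\<sigma>\<close> and the odd ones those of \<open>P\<close>.\<close>
lemma definable_pred_subst:
  assumes P: "definable_pred M P" and \<sigma>: "\<And>v. definable_term M (\<lambda>s. \<sigma> s v)"
  shows "definable_pred M (\<lambda>s. P (\<sigma> s))"
proof -
  obtain n where n: "\<forall>s s'. (\<forall>v<n. s v = s' v) \<longrightarrow> P s = P s'" using definable_pred_finite_support[OF P] by blast
  let ?e = "\<lambda>k s v. if v < k then \<sigma> (\<lambda>j. s (2 * j)) v else s (2 * v + 1)"
  have "definable_pred M (\<lambda>s. P (?e k s))" for k
  proof (induction k)
    case 0
    then show ?case using definable_pred_rename[OF P, of "\<lambda>v. 2 * v + 1"] by simp
  next
    case (Suc k)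
    \<comment> \<open>The variable \<open>2 * k + 1\<close> is quantified subject to being equal to
      the new value. As \<open>\<sigma>\<close> reads even variables only, the quantifier does not
      disturb it.\<close>
    let ?Q = "\<lambda>s. s (2 * k + 1) = \<sigma> (\<lambda>j. s (2 * j)) k \<and> P (?e k s)"
    have "definable_pred M (\<lambda>s. s (2 * k + 1) = \<sigma> (\<lambda>j. s (2 * j)) k)"
      using definable_pred_rename[OF \<sigma>[of k, unfolded definable_term_def definable_rel_def], of "case_nat (2 * k + 1) (\<lambda>j. 2 * j)"] by simp
    then have "definable_pred M (\<lambda>s. \<exists>a. ?Q (s(2 * k + 1 := a)))" by (intro definable_pred_Ex_update definable_pred_conj Suc)
    moreover have "(\<exists>a. ?Q (s(2 * k + 1 := a))) = P (?e (Suc k) s)" for s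
    proof -
      have odd: "2 * j \<noteq> 2 * k + 1" for j :: nat by presburger
      have "?e k (s(2 * k + 1 := \<sigma> (\<lambda>j. s (2 * j)) k)) = ?e (Suc k) s"
        using odd by (auto simp: fun_eq_iff less_Suc_eq)
      then show ?thesis using odd by (simp add: fun_upd_def)
    qed
    ultimately show ?case by simp
  qed
  \<comment> \<open>Halving the index makes the even and the odd copy coincide; since
    \<open>P\<close> depends on the first \<open>n\<close> variables only, \<open>n\<close>
    replacements are enough.\<close>
  then have "definable_pred M (\<lambda>s. P (?e n (\<lambda>v. s (v div 2))))"
    by (rule definable_pred_rename[of M "\<lambda>s. P (?e n s)" "\<lambda>v. v div 2"])
  moreover have "P (?e n (\<lambda>v. s (v div 2))) = P (\<sigma> s)" for s
    by (rule n[rule_format]) simp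
  ultimately show ?thesis by simp
qed

lemma definable_rel_app:
  assumes F: "definable_rel M F" and \<sigma>: "\<And>v. definable_term M (\<lambda>s. \<sigma> s v)" and t: "definable_term M t"
  shows "definable_pred M (\<lambda>s. F (\<sigma> s) (t s))"
proof -
  have "definable_term M (\<lambda>s. case_nat (t s) (\<sigma> s) v)" for v
    by (cases v) (use \<sigma> t in simp_all)
  then have "definable_pred M (\<lambda>s. F (\<lambda>v. case_nat (t s) (\<sigma> s) (Suc v)) (case_nat (t s) (\<sigma> s) 0))"
    by (rule definable_pred_subst[OF F[unfolded definable_rel_def], of "\<lambda>s. case_nat (t s) (\<sigma> s)"])
  then show ?thesis by simp
qed

lemma definable_term_var: "definable_term M (\<lambda>s. s k)"
  unfolding definable_term_def definable_rel_def definable_pred_def by (rule exI[of _ "Eq (Var 0) (Var (Suc k))"]) simp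

lemma definable_term_fun_upd: "definable_term M (\<lambda>s. \<sigma> s v) \<Longrightarrow> definable_term M t \<Longrightarrow> definable_term M (\<lambda>s. ((\<sigma> s)(n := t s)) v)"
  by (cases "v = n") simp_all

lemma definable_pred_eq:
  assumes "definable_term M t" and "definable_term M u"
  shows "definable_pred M (\<lambda>s. t s = u s)"
  using definable_rel_app[OF assms(2)[unfolded definable_term_def], of "\<lambda>s. s" t] assms(1) definable_term_var by blast

lemmas definable_pred_intros = definable_pred_Not definable_pred_conj definable_pred_disj definable_pred_imp definable_pred_iff definable_pred_Ex definable_pred_All definable_pred_True definable_pred_eq
  definable_term_var definable_term_fun_upd

section \<open>The ordered group and the bound on the size of patterns\<close>

definition pattern :: "((nat \<Rightarrow> 'a) \<Rightarrow> 'a \<Rightarrow> bool) \<Rightarrow> ((nat \<Rightarrow> 'a) \<Rightarrow> 'a \<Rightarrow> bool) \<Rightarrow> nat \<Rightarrow> bool" where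
  "pattern \<Phi> \<Psi> k \<longleftrightarrow> (\<exists>a b x. \<forall>i<k. \<forall>j<k.
    (\<forall>l<k. \<Phi> (a l) (x i j) \<longleftrightarrow> l = i) \<and> (\<forall>l<k. \<Psi> (b l) (x i j) \<longleftrightarrow> l = j))"

locale dp_minimal_group =
  fixes M :: "('a::linordered_ab_group_add, 'f, 'r) struct" and pl :: 'f and ls :: 'r
  assumes plus: "fst M pl [x, y] = x + y"
    and less: "snd M ls [x, y] \<longleftrightarrow> x < y"
    and divisible: "(n::nat) > 0 \<Longrightarrow> \<exists>y::'a. (\<Sum>i<n. y) = x"
    and nontrivial: "\<exists>x::'a. x \<noteq> 0"
    and dpmin: "dp_minimal M"
begin

lemma definable_term_add:
  assumes "definable_term M t" and "definable_term M u"
  shows "definable_term M (\<lambda>s. t s + u s)"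
proof -
  have F: "definable_rel M (\<lambda>s a. a = s 0 + s 1)"
    unfolding definable_rel_def definable_pred_def
    by (rule exI[of _ "Eq (Var 0) (Fun pl [Var 1, Var 2])"]) (simp add: plus numeral_2_eq_2)
  have "definable_term M (\<lambda>s. (case_nat (t (\<lambda>v. s (Suc v))) (\<lambda>_. u (\<lambda>v. s (Suc v)))) v)" for v
    by (cases v) (use definable_term_rename[OF assms(1), of Suc] definable_term_rename[OF assms(2), of Suc] in simp_all)
  then have "definable_pred M (\<lambda>s. s 0 = (case_nat (t (\<lambda>v. s (Suc v))) (\<lambda>_. u (\<lambda>v. s (Suc v)))) 0 +
      (case_nat (t (\<lambda>v. s (Suc v))) (\<lambda>_. u (\<lambda>v. s (Suc v)))) 1)"
    by (rule definable_rel_app[OF F _ definable_term_var[of M 0], of "\<lambda>s. case_nat (t (\<lambda>v. s (Suc v))) (\<lambda>_. u (\<lambda>v. s (Suc v)))"])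
  then show ?thesis by (simp add: definable_term_def definable_rel_def)
qed

lemma definable_pred_less:
  assumes "definable_term M t" and "definable_term M u"
  shows "definable_pred M (\<lambda>s. t s < u s)"
proof -
  have F: "definable_rel M (\<lambda>s a. a < s 0)"
    unfolding definable_rel_def definable_pred_def
    by (rule exI[of _ "Rel ls [Var 0, Var 1]"]) (simp add: less)
  show ?thesis by (rule definable_rel_app[OF F _ assms(1), of "\<lambda>s _. u s"]) (rule assms)
qed

lemma definable_pred_le: "definable_term M t \<Longrightarrow> definable_term M u \<Longrightarrow> definable_pred M (\<lambda>s. t s \<le> u s)"
  using definable_pred_Not[OF definable_pred_less[of u t]] by (simp add: not_less)

text \<open>Only addition and the order have symbols; the graph of subtraction is given by an
  equation between sums.\<close>

lemma definable_term_diff: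
  assumes "definable_term M t" and "definable_term M u"
  shows "definable_term M (\<lambda>s. t s - u s)"
proof -
  have "definable_pred M (\<lambda>s. s 0 + u (\<lambda>v. s (Suc v)) = t (\<lambda>v. s (Suc v)))"
    by (intro definable_pred_eq definable_term_add definable_term_var definable_term_rename[OF assms(1)] definable_term_rename[OF assms(2)])
  then show ?thesis by (simp add: definable_term_def definable_rel_def eq_diff_eq)
qed

lemma definable_term_zero: "definable_term M (\<lambda>s. 0)"
  using definable_term_diff[OF definable_term_var[of M 0] definable_term_var[of M 0]] by simp

lemma definable_term_minus: "definable_term M t \<Longrightarrow> definable_term M (\<lambda>s. - t s)"
  using definable_term_diff[OF definable_term_zero, of t] by simp

lemmas intros = definable_pred_intros definable_pred_less definable_pred_le definable_term_add definable_term_diff definable_term_zero definable_term_minus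

lemma between: "(u::'a) < v \<Longrightarrow> \<exists>w. u < w \<and> w < v"
proof -
  assume uv: "u < v"
  obtain w where w: "w + w = u + v" using divisible[of 2 "u + v"] by (auto simp: numeral_2_eq_2)
  have "u < w"
  proof (rule ccontr)
    assume "\<not> u < w"
    then have "w + w \<le> u + u" by (simp add: add_mono)
    then show False using w uv by simp
  qed
  moreover have "w < v"
  proof (rule ccontr)
    assume "\<not> w < v"
    then have "v + v \<le> w + w" by (simp add: add_mono)
    then show False using w uv by simp
  qed
  ultimately show ?thesis by blast
qed

lemma infinite_UNIV: "infinite (UNIV :: 'a set)"
proof
  assume fin: "finite (UNIV :: 'a set)"
  obtain x :: 'a where "x > 0" using nontrivial by (meson neg_0_less_iff_less neqE)
  moreover have "Max (UNIV :: 'a set) + x \<le> Max UNIV" by (rule Max_ge[OF fin UNIV_I])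
  ultimately show False by simp
qed

text \<open>Compactness read backwards. The bound \<open>k\<close> depends on the two relations
  alone, while their parameters vary freely inside \<open>pattern\<close>.\<close>

lemma no_pattern:
  assumes \<Phi>: "definable_rel M \<Phi>" and \<Psi>: "definable_rel M \<Psi>"
  shows "\<exists>k. \<not> pattern \<Phi> \<Psi> k"
proof (rule ccontr)
  assume *: "\<not> ?thesis"
  obtain \<phi> where \<phi>: "\<forall>s. sat M s \<phi> = \<Phi> (\<lambda>v. s (Suc v)) (s 0)" using \<Phi> by (auto simp: definable_pred_def definable_rel_def)
  obtain \<psi> where \<psi>: "\<forall>s. sat M s \<psi> = \<Psi> (\<lambda>v. s (Suc v)) (s 0)" using \<Psi> by (auto simp: definable_pred_def definable_rel_def)
  have "\<exists>a b x. \<forall>i<k. \<forall>j<k. (\<forall>l<k. sat M ((a l)(0 := x i j)) \<phi> \<longleftrightarrow> l = i) \<and>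
      (\<forall>l<k. sat M ((b l)(0 := x i j)) \<psi> \<longleftrightarrow> l = j)" for k :: nat
  proof -
    from * have "pattern \<Phi> \<Psi> k" by blast
    then obtain a b x where abx: "\<forall>i<k. \<forall>j<k. (\<forall>l<k. \<Phi> (a l) (x i j) \<longleftrightarrow> l = i) \<and> (\<forall>l<k. \<Psi> (b l) (x i j) \<longleftrightarrow> l = j)"
      unfolding pattern_def by (elim exE)
    show ?thesis
      by (rule exI[of _ "\<lambda>l. case_nat undefined (a l)"], rule exI[of _ "\<lambda>l. case_nat undefined (b l)"],
          rule exI[of _ x]) (simp add: \<phi> \<psi> abx)
  qed
  from patterns_imp_not_dp_minimal[OF infinite_UNIV this] dpmin show False by blast
qed

end

section \<open>Germs\<close>

text \<open>A minimal set of points separating the members of \<open>A\<close> contains, for each of its points,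
  a pair of members that is separated by this point only.\<close>
lemma exclusive_differences:
  fixes f :: "'b \<Rightarrow> 't \<Rightarrow> bool"
  assumes fin: "finite A" and card: "2 ^ k < card A"
    and sep: "\<And>a b. a \<in> A \<Longrightarrow> b \<in> A \<Longrightarrow> a \<noteq> b \<Longrightarrow> \<exists>t\<in>T. f a t \<noteq> f b t"
  shows "\<exists>t g. \<forall>j<k. t j \<in> T \<and> g j \<in> A \<times> A \<and>
    (\<forall>l<k. f (fst (g l)) (t j) \<noteq> f (snd (g l)) (t j) \<longleftrightarrow> l = (j::nat))"
proof -
  define separates where
    "separates S \<longleftrightarrow> finite S \<and> S \<subseteq> T \<and> (\<forall>a\<in>A. \<forall>b\<in>A. a \<noteq> b \<longrightarrow> (\<exists>t\<in>S. f a t \<noteq> f b t))" for S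
  have "\<forall>p\<in>{p \<in> A \<times> A. fst p \<noteq> snd p}. \<exists>t. t \<in> T \<and> f (fst p) t \<noteq> f (snd p) t" using sep by fastforce
  from bchoice[OF this] obtain w where
    w: "\<forall>p\<in>{p \<in> A \<times> A. fst p \<noteq> snd p}. w p \<in> T \<and> f (fst p) (w p) \<noteq> f (snd p) (w p)" by blast
  have "separates (w ` {p \<in> A \<times> A. fst p \<noteq> snd p})"
    unfolding separates_def using fin w by fastforce
  then obtain S where S: "separates S" and min: "\<And>S'. separates S' \<Longrightarrow> card S \<le> card S'"
    using ex_has_least_nat[of separates _ card] by blast
  have finS: "finite S" using S by (simp add: separates_def)
  \<comment> \<open>A member of \<open>A\<close> is determined by its trace on \<open>S\<close>;
    this is why more than \<open>2 ^ k\<close> members force more than \<open>k\<close> separating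
    points.\<close>
  have "card A \<le> card (Pow S)"
  proof (rule card_inj_on_le[of "\<lambda>a. {t \<in> S. f a t}"])
    show "inj_on (\<lambda>a. {t \<in> S. f a t}) A"
    proof (rule inj_onI, rule ccontr)
      fix a b assume "a \<in> A" "b \<in> A" "{t \<in> S. f a t} = {t \<in> S. f b t}" "a \<noteq> b"
      then show False using S unfolding separates_def by blast
    qed
  qed (use finS in auto)
  then have "(2::nat) ^ k < 2 ^ card S" using card card_Pow[OF finS] by linarith
  then have kS: "k < card S" by (rule power_less_imp_less_exp[rotated]) simp
  have "\<exists>p\<in>A \<times> A. \<forall>t\<in>S. f (fst p) t \<noteq> f (snd p) t \<longleftrightarrow> t = u" if u: "u \<in> S" for u
  proof -
    have "card (S - {u}) < card S" using finS u by (rule card_Diff1_less)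
    then have "\<not> separates (S - {u})" using min[of "S - {u}"] by linarith
    moreover have "finite (S - {u}) \<and> S - {u} \<subseteq> T" using S by (auto simp: separates_def)
    ultimately have "\<not> (\<forall>a\<in>A. \<forall>b\<in>A. a \<noteq> b \<longrightarrow> (\<exists>t\<in>S - {u}. f a t \<noteq> f b t))"
      unfolding separates_def by simp
    then obtain a b where ab: "a \<in> A" "b \<in> A" "a \<noteq> b" "\<forall>t\<in>S - {u}. f a t = f b t" by blast
    moreover have "f a u \<noteq> f b u" using ab S unfolding separates_def by blast
    ultimately show ?thesis by (intro bexI[of _ "(a, b)"]) auto
  qed
  then have "\<forall>u\<in>S. \<exists>p. p \<in> A \<times> A \<and> (\<forall>t\<in>S. f (fst p) t \<noteq> f (snd p) t \<longleftrightarrow> t = u)" by blast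
  from bchoice[OF this] obtain p where p: "\<forall>u\<in>S. p u \<in> A \<times> A \<and> (\<forall>t\<in>S. f (fst (p u)) t \<noteq> f (snd (p u)) t \<longleftrightarrow> t = u)"
    by blast
  obtain h where h: "bij_betw h {0..<card S} S" using ex_bij_betw_nat_finite[OF finS] by blast
  have hS: "h j \<in> S" if "j < k" for j using bij_betwE[OF h] that kS by auto
  have inj: "h l = h j \<longleftrightarrow> l = j" if "j < k" "l < k" for j l
    using bij_betw_imp_inj_on[OF h] that kS by (auto simp: inj_on_def)
  have "h j \<in> T \<and> p (h j) \<in> A \<times> A \<and> (\<forall>l<k. f (fst (p (h l))) (h j) \<noteq> f (snd (p (h l))) (h j) \<longleftrightarrow> l = j)"
    if j: "j < k" for j
  proof (intro conjI allI impI)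
    show "h j \<in> T" using hS[OF j] S by (auto simp: separates_def)
    show "p (h j) \<in> A \<times> A" using hS[OF j] p by blast
    fix l assume l: "l < k"
    show "f (fst (p (h l))) (h j) \<noteq> f (snd (p (h l))) (h j) \<longleftrightarrow> l = j"
      using p hS[OF j] hS[OF l] inj[OF j l] by metis
  qed
  then show ?thesis by (intro exI[of _ h] exI[of _ "\<lambda>j. p (h j)"]) blast
qed

lemma pattern_0: "pattern \<Phi> \<Psi> 0"
  by (simp add: pattern_def)

context dp_minimal_group
begin

lemma disjoint_subintervals:
  "(u::'a) < v \<Longrightarrow> \<exists>lo hi. (\<forall>i<k. u \<le> lo i \<and> lo i < hi i \<and> hi i \<le> v) \<and>
    (\<forall>i<k. \<forall>j<k. i \<noteq> j \<longrightarrow> hi i \<le> lo j \<or> hi j \<le> lo (i::nat))"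
proof (induction k arbitrary: v)
  case (Suc k)
  obtain w where w: "u < w" "w < v" using between[OF Suc.prems] by blast
  from Suc.IH[OF w(1)] obtain lo hi where lh: "\<forall>i<k. u \<le> lo i \<and> lo i < hi i \<and> hi i \<le> w"
    "\<forall>i<k. \<forall>j<k. i \<noteq> j \<longrightarrow> hi i \<le> lo j \<or> hi j \<le> lo i" by blast
  have "\<forall>i<Suc k. u \<le> (lo(k := w)) i \<and> (lo(k := w)) i < (hi(k := v)) i \<and> (hi(k := v)) i \<le> v"
    using lh(1) w by (auto simp: less_Suc_eq intro: order_trans less_imp_le)
  moreover have "\<forall>i<Suc k. \<forall>j<Suc k. i \<noteq> j \<longrightarrow> (hi(k := v)) i \<le> (lo(k := w)) j \<or> (hi(k := v)) j \<le> (lo(k := w)) i"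
    using lh w by (auto simp: less_Suc_eq)
  ultimately show ?case by blast
qed simp

text \<open>One of the two families of a pattern can always be \<open>k\<close> disjoint intervals,
  with their endpoints as parameters. These are fixed in advance, so a contradiction only requires
  \<open>k\<close> exclusive instances of \<open>\<Psi>\<close>, each of them meeting every
  interval.\<close>

lemma no_interval_pattern:
  assumes \<Psi>: "definable_rel M \<Psi>" and uv: "u < v"
  shows "\<exists>(k::nat) lo hi. (\<forall>i<k. u \<le> lo i \<and> lo i < hi i \<and> hi i \<le> v) \<and>
    \<not> (\<exists>b x. \<forall>i<k. \<forall>j<k. lo i < x i j \<and> x i j < hi i \<and> (\<forall>l<k. \<Psi> (b l) (x i j) \<longleftrightarrow> l = j))"
proof -
  let ?\<Phi> = "\<lambda>e x. e 0 < x \<and> x < (e (Suc 0) :: 'a)"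
  have "definable_rel M ?\<Phi>" unfolding definable_rel_def by (intro intros)
  then obtain k where k: "\<not> pattern ?\<Phi> \<Psi> k" using no_pattern[OF _ \<Psi>] by blast
  obtain lo hi where lh: "\<forall>i<k. u \<le> lo i \<and> lo i < hi i \<and> hi i \<le> v"
    "\<forall>i<k. \<forall>j<k. i \<noteq> j \<longrightarrow> hi i \<le> lo j \<or> hi j \<le> lo i"
    using disjoint_subintervals[OF uv, of k] by blast
  have "pattern ?\<Phi> \<Psi> k"
    if bx: "\<forall>i<k. \<forall>j<k. lo i < x i j \<and> x i j < hi i \<and> (\<forall>l<k. \<Psi> (b l) (x i j) \<longleftrightarrow> l = j)" for b x
  proof -
    have "(lo l < x i j \<and> x i j < hi l) \<longleftrightarrow> l = i" if ijl: "i < k" "j < k" "l < k" for i j l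
    proof
      assume 1: "lo l < x i j \<and> x i j < hi l"
      have 2: "lo i < x i j \<and> x i j < hi i" using bx ijl by blast
      show "l = i"
      proof (rule ccontr)
        assume "l \<noteq> i"
        then have "hi i \<le> lo l \<or> hi l \<le> lo i" using lh(2) ijl by blast
        with 1 2 show False by auto
      qed
    qed (use bx ijl in blast)
    then show ?thesis unfolding pattern_def
      by (intro exI[of _ "\<lambda>l. case_nat (lo l) (\<lambda>_. hi l)"] exI[of _ b] exI[of _ x]) (use bx in auto)
  qed
  with k lh show ?thesis by blast
qed

text \<open>The offset 0 is left out so that finitely many points separating two germs stay away
  from 0 and can be avoided by a smaller neighbourhood.\<close>

definition near :: "('a \<Rightarrow> bool) \<Rightarrow> 'a \<Rightarrow> 'a \<Rightarrow> 'a \<Rightarrow> bool" where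
  "near Y \<epsilon> a b \<longleftrightarrow> (\<forall>t. t \<noteq> 0 \<longrightarrow> - \<epsilon> < t \<longrightarrow> t < \<epsilon> \<longrightarrow> Y (a + t) = Y (b + t))"

definition germ_eq :: "('a \<Rightarrow> bool) \<Rightarrow> 'a \<Rightarrow> 'a \<Rightarrow> bool" where
  "germ_eq Y a b \<longleftrightarrow> (\<exists>\<epsilon>>0. near Y \<epsilon> a b)"

lemma near_mono: "near Y \<epsilon> a b \<Longrightarrow> \<delta> \<le> \<epsilon> \<Longrightarrow> near Y \<delta> a b"
  unfolding near_def by (meson le_imp_neg_le order_less_le_trans order_le_less_trans)

lemma near_sym: "near Y \<epsilon> a b \<Longrightarrow> near Y \<epsilon> b a"
  by (simp add: near_def)

lemma near_trans: "near Y \<epsilon> a b \<Longrightarrow> near Y \<epsilon> b c \<Longrightarrow> near Y \<epsilon> a c"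
  by (simp add: near_def)

lemma germ_eq_sym: "germ_eq Y a b \<Longrightarrow> germ_eq Y b a"
  unfolding germ_eq_def using near_sym by blast

lemma germ_eq_trans:
  assumes "germ_eq Y a b" and "germ_eq Y b c"
  shows "germ_eq Y a c"
proof -
  obtain \<epsilon> \<delta> where "\<epsilon> > 0" "near Y \<epsilon> a b" "\<delta> > 0" "near Y \<delta> b c" using assms by (auto simp: germ_eq_def)
  then have "near Y (min \<epsilon> \<delta>) a c" by (meson near_mono near_trans min.cobounded1 min.cobounded2)
  then show ?thesis unfolding germ_eq_def using \<open>\<epsilon> > 0\<close> \<open>\<delta> > 0\<close> by (intro exI[of _ "min \<epsilon> \<delta>"]) simp
qed

lemma ex_pos: "\<exists>e::'a. e > 0"
  using nontrivial by (meson neg_0_less_iff_less neqE)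

text \<open>If many germs were distinct, the differences of the same pairs of translates would be
  exclusive in arbitrarily small punctured neighbourhoods of 0, hence in a sequence of disjoint shells.\<close>
lemma finite_germs:
  assumes X: "definable_rel M X"
  shows "\<exists>K::nat. \<forall>A. finite A \<longrightarrow> K < card A \<longrightarrow> (\<exists>a\<in>A. \<exists>b\<in>A. a \<noteq> b \<and> germ_eq (X s) a b)"
proof -
  \<comment> \<open>\<open>?\<Phi>\<close> is a symmetric shell around 0. In \<open>?\<Psi>\<close>
    the first two entries of \<open>e\<close> are the members of a pair, the later ones the
    parameters of \<open>X\<close>.\<close>
  let ?\<Phi> = "\<lambda>e t. (- e 0 < t \<and> t < e 0) \<and> \<not> (- e (Suc 0) < t \<and> t < (e (Suc 0) :: 'a))"
  let ?\<Psi> = "\<lambda>e t. \<not> (X (\<lambda>v. e (Suc (Suc v))) (e 0 + t) \<longleftrightarrow> X (\<lambda>v. e (Suc (Suc v))) (e (Suc 0) + t))"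
  have "definable_rel M ?\<Phi>" unfolding definable_rel_def by (intro intros)
  moreover have "definable_rel M ?\<Psi>" unfolding definable_rel_def by (intro intros definable_rel_app[OF X])
  ultimately obtain k where k: "\<not> pattern ?\<Phi> ?\<Psi> k" using no_pattern by blast
  have k0: "k > 0"
  proof (rule gr0I)
    assume "k = 0"
    show False using k unfolding \<open>k = 0\<close> by (rule notE) (rule pattern_0)
  qed
  have "\<exists>a\<in>A. \<exists>b\<in>A. a \<noteq> b \<and> germ_eq (X s) a b" if fin: "finite A" and card: "2 ^ k < card A" for A
  proof (rule ccontr)
    assume *: "\<not> ?thesis"
    define Q where "Q g \<epsilon> \<longleftrightarrow> (\<exists>t. \<forall>j<k. t j \<noteq> 0 \<and> - \<epsilon> < t j \<and> t j < \<epsilon> \<and>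
      (\<forall>l<k. X s (fst (g l) + t j) \<noteq> X s (snd (g l) + t j) \<longleftrightarrow> l = j))" for g \<epsilon>
    have Q_mono: "Q g \<delta>" if Q: "Q g \<epsilon>" and le: "\<epsilon> \<le> \<delta>" for g \<epsilon> \<delta>
    proof -
      obtain t where t: "\<forall>j<k. t j \<noteq> 0 \<and> - \<epsilon> < t j \<and> t j < \<epsilon> \<and>
          (\<forall>l<k. X s (fst (g l) + t j) \<noteq> X s (snd (g l) + t j) \<longleftrightarrow> l = j)"
        using Q unfolding Q_def by (elim exE)
      have "- \<delta> < t j \<and> t j < \<delta>" if "j < k" for j
        using t[rule_format, OF that] le order_le_less_trans[of "- \<delta>" "- \<epsilon>" "t j"]
          order_less_le_trans[of "t j" \<epsilon> \<delta>] by simp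
      with t show ?thesis unfolding Q_def by (intro exI[of _ t]) simp
    qed
    define G where "G = {g. \<forall>x. (x \<in> {..<k} \<longrightarrow> g x \<in> A \<times> A) \<and> (x \<notin> {..<k} \<longrightarrow> g x = undefined)}"
    have finG: "finite G" unfolding G_def by (rule finite_set_of_finite_funs) (use fin in auto)
    have ex: "\<exists>g\<in>G. Q g \<epsilon>" if "\<epsilon> > 0" for \<epsilon>
    proof -
      have "\<exists>t\<in>{t. t \<noteq> 0 \<and> - \<epsilon> < t \<and> t < \<epsilon>}. X s (a + t) \<noteq> X s (b + t)" if "a \<in> A" "b \<in> A" "a \<noteq> b" for a b
        using * that \<open>\<epsilon> > 0\<close> unfolding germ_eq_def near_def by blast
      from exclusive_differences[where f = "\<lambda>a t. X s (a + t)", OF fin card this] obtain t g where tg: "\<forall>j<k. t j \<in> {t. t \<noteq> 0 \<and> - \<epsilon> < t \<and> t < \<epsilon>} \<and> g j \<in> A \<times> A \<and>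
        (\<forall>l<k. X s (fst (g l) + t j) \<noteq> X s (snd (g l) + t j) \<longleftrightarrow> l = j)" by blast
      let ?g = "\<lambda>x. if x < k then g x else undefined"
      have "?g \<in> G" using tg by (simp add: G_def)
      moreover have "Q ?g \<epsilon>" unfolding Q_def using tg by (intro exI[of _ t]) simp
      ultimately show ?thesis by blast
    qed
    \<comment> \<open>One tuple of pairs must serve all radii, since the parameters of
      \<open>?\<Psi>\<close> may not change with the shell. There are only finitely many tuples, and
      a tuple that fails at one radius fails at all smaller ones.\<close>
    have "\<exists>g\<in>G. \<forall>\<epsilon>>0. Q g \<epsilon>"
    proof (rule ccontr)
      assume "\<not> ?thesis"
      then have "\<forall>g\<in>G. \<exists>\<epsilon>. \<epsilon> > 0 \<and> \<not> Q g \<epsilon>" by blast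
      from bchoice[OF this] obtain d where d: "\<forall>g\<in>G. d g > 0 \<and> \<not> Q g (d g)" by blast
      have ne: "G \<noteq> {}" using ex ex_pos by blast
      have "Min (d ` G) > 0" using finG ne d by simp
      then obtain g where "g \<in> G" "Q g (Min (d ` G))" using ex by blast
      then show False using Q_mono[of g "Min (d ` G)" "d g"] finG d by simp
    qed
    then obtain g where g: "\<And>\<epsilon>. \<epsilon> > 0 \<Longrightarrow> Q g \<epsilon>" by blast
    define R where "R \<epsilon> \<delta> t \<longleftrightarrow> (\<forall>j<k. (- \<epsilon> < t j \<and> t j < \<epsilon>) \<and> \<not> (- \<delta> < t j \<and> t j < \<delta>) \<and>
      (\<forall>l<k. X s (fst (g l) + t j) \<noteq> X s (snd (g l) + t j) \<longleftrightarrow> l = j))" for \<epsilon> \<delta> t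
    have "\<exists>e :: nat \<Rightarrow> 'a. \<forall>n. e n > 0 \<and> (e (Suc n) \<le> e n \<and> (\<exists>t. R (e n) (e (Suc n)) t))"
    proof (rule dependent_nat_choice)
      show "\<exists>e::'a. e > 0" by (rule ex_pos)
      fix \<epsilon> :: 'a and n :: nat assume "\<epsilon> > 0"
      from g[OF this] obtain t where t: "\<forall>j<k. t j \<noteq> 0 \<and> - \<epsilon> < t j \<and> t j < \<epsilon> \<and>
        (\<forall>l<k. X s (fst (g l) + t j) \<noteq> X s (snd (g l) + t j) \<longleftrightarrow> l = j)" unfolding Q_def by blast
      \<comment> \<open>\<open>max (t j) (- t j)\<close> is the absolute value. The next radius is
        the least one among the points just used, so all later neighbourhoods miss these points; it
        is positive because germs are punctured.\<close>
      let ?S = "(\<lambda>j. max (t j) (- t j)) ` {..<k}"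
      have S: "finite ?S" "?S \<noteq> {}" using k0 by auto
      have "Min ?S > 0"
        using S t by (auto simp: less_max_iff_disj)
      moreover have min: "Min ?S \<le> max (t j) (- t j)" if "j < k" for j using S that by simp
      moreover have "max (t 0) (- t 0) < \<epsilon>" using t k0 minus_less_iff by auto
      then have "Min ?S \<le> \<epsilon>" using order_trans[OF min[OF k0] less_imp_le] by blast
      moreover have "R \<epsilon> (Min ?S) t"
        unfolding R_def
      proof (intro allI impI conjI)
        fix j assume j: "j < k"
        show "\<not> (- Min ?S < t j \<and> t j < Min ?S)"
          using min[OF j] by (auto simp: le_max_iff_disj minus_less_iff not_less le_minus_iff)
      qed (use t in blast)+
      ultimately show "\<exists>\<delta>. \<delta> > 0 \<and> (\<delta> \<le> \<epsilon> \<and> (\<exists>t. R \<epsilon> \<delta> t))" by blast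
    qed
    then obtain e :: "nat \<Rightarrow> 'a" where e: "\<And>n. e n > 0" "\<And>n. e (Suc n) \<le> e n" "\<And>n. \<exists>t. R (e n) (e (Suc n)) t"
      by blast
    then have "\<exists>t. \<forall>n. R (e n) (e (Suc n)) (t n)" by (intro choice) blast
    then obtain t where t: "\<And>n. R (e n) (e (Suc n)) (t n)" by blast
    have anti: "e n \<le> e m" if "m \<le> n" for m n by (rule lift_Suc_antimono_le[of e]) (use e(2) that in auto)
    have \<Phi>: "?\<Phi> (case_nat (e l) (\<lambda>_. e (Suc l))) (t i j) \<longleftrightarrow> l = i" if ij: "i < k" "j < k" for i j l
    proof -
      have tij: "- e i < t i j" "t i j < e i" "\<not> (- e (Suc i) < t i j \<and> t i j < e (Suc i))"
        using t[of i] ij unfolding R_def by auto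
      consider "l < i" | "l = i" | "i < l" by linarith
      then show ?thesis
      proof cases
        case 1
        then have "e i \<le> e (Suc l)" by (intro anti) simp
        then have "- e (Suc l) < t i j" "t i j < e (Suc l)"
          using tij by (meson le_imp_neg_le order_le_less_trans order_less_le_trans)+
        with 1 show ?thesis by simp
      next
        case 2
        then show ?thesis using tij by simp
      next
        case 3
        then have "e l \<le> e (Suc i)" by (intro anti) simp
        then have "\<not> (- e l < t i j \<and> t i j < e l)"
          using tij(3) by (meson le_imp_neg_le order_le_less_trans order_less_le_trans)
        with 3 show ?thesis by auto
      qed
    qed
    have \<Psi>: "?\<Psi> (case_nat (fst (g l)) (case_nat (snd (g l)) s)) (t i j) \<longleftrightarrow> l = j" if "i < k" "j < k" "l < k" for i j l
      using t[of i] that unfolding R_def by simp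
    have "pattern ?\<Phi> ?\<Psi> k" unfolding pattern_def
      by (rule exI[of _ "\<lambda>l. case_nat (e l) (\<lambda>_. e (Suc l))"],
          rule exI[of _ "\<lambda>l. case_nat (fst (g l)) (case_nat (snd (g l)) s)"], rule exI[of _ t])
        (intro allI impI conjI, rule \<Phi>, assumption+, rule \<Psi>, assumption+)
    with k show False by (rule notE)
  qed
  then show ?thesis by blast
qed

end

section \<open>Boxes and lower bounds\<close>

text \<open>Points of \<open>G\<^sup>n\<close> are the assignments that agree with a parameter assignment \<open>s\<close> from
  variable \<open>n\<close> on, so that fixing the last coordinate of a point amounts to changing \<open>s\<close>.\<close>
definition box :: "nat \<Rightarrow> (nat \<Rightarrow> 'a::linorder) \<Rightarrow> (nat \<Rightarrow> 'a) \<Rightarrow> (nat \<Rightarrow> 'a) \<Rightarrow> (nat \<Rightarrow> 'a) set" where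
  "box n lo hi s = {x. (\<forall>i<n. lo i < x i \<and> x i < hi i) \<and> (\<forall>i\<ge>n. x i = s i)}"

definition subbox :: "nat \<Rightarrow> (nat \<Rightarrow> 'a::linorder) \<Rightarrow> (nat \<Rightarrow> 'a) \<Rightarrow> (nat \<Rightarrow> 'a) \<Rightarrow> (nat \<Rightarrow> 'a) \<Rightarrow> bool" where
  "subbox n lo hi lo' hi' \<longleftrightarrow> (\<forall>i<n. lo i \<le> lo' i \<and> lo' i < hi' i \<and> hi' i \<le> hi i)"

lemma subbox_refl: "\<forall>i<n. lo i < hi i \<Longrightarrow> subbox n lo hi lo hi"
  by (simp add: subbox_def)

lemma subbox_proper: "subbox n lo hi lo' hi' \<Longrightarrow> \<forall>i<n. lo' i < hi' i"
  by (simp add: subbox_def)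

lemma subbox_trans: "subbox n lo hi lo' hi' \<Longrightarrow> subbox n lo' hi' lo'' hi'' \<Longrightarrow> subbox n lo hi lo'' hi''"
  unfolding subbox_def by (meson order_trans)

lemma box_mono:
  assumes "subbox n lo hi lo' hi'" and "x \<in> box n lo' hi' s"
  shows "x \<in> box n lo hi s"
proof -
  have "lo i < x i \<and> x i < hi i" if "i < n" for i
  proof -
    have "lo i \<le> lo' i" "hi' i \<le> hi i" "lo' i < x i" "x i < hi' i"
      using assms that by (auto simp: subbox_def box_def)
    then show ?thesis by auto
  qed
  then show ?thesis using assms(2) by (simp add: box_def)
qed

text \<open>The fibre at height \<open>c\<close> of a box of dimension \<open>n + 1\<close> is a box
  of dimension \<open>n\<close> with one parameter changed. This is how the inductive hypotheses,
  which hold for every \<open>s\<close>, are applied to fibres.\<close>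

lemma box_update_param:
  "(\<forall>x\<in>box n lo hi (s(n := c)). Q x) \<longleftrightarrow> (\<forall>x\<in>box n lo hi s. Q (x(n := c)))"
proof (intro iffI ballI)
  fix x assume *: "\<forall>x\<in>box n lo hi s. Q (x(n := c))" and x: "x \<in> box n lo hi (s(n := c))"
  have "x(n := s n) \<in> box n lo hi s" using x by (auto simp: box_def)
  then have "Q ((x(n := s n))(n := c))" using * by blast
  moreover have "(x(n := s n))(n := c) = x" using x by (auto simp: box_def)
  ultimately show "Q x" by simp
next
  fix x assume *: "\<forall>x\<in>box n lo hi (s(n := c)). Q x" and x: "x \<in> box n lo hi s"
  have "x(n := c) \<in> box n lo hi (s(n := c))" using x by (auto simp: box_def)
  then show "Q (x(n := c))" using * by blast
qed

lemma box_Suc_iff: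
  "(\<forall>x\<in>box (Suc n) lo hi s. Q x) \<longleftrightarrow> (\<forall>c. lo n < c \<and> c < hi n \<longrightarrow> (\<forall>x\<in>box n lo hi s. Q (x(n := c))))"
proof (intro iffI ballI allI impI)
  fix x assume *: "\<forall>c. lo n < c \<and> c < hi n \<longrightarrow> (\<forall>x\<in>box n lo hi s. Q (x(n := c)))" and x: "x \<in> box (Suc n) lo hi s"
  have "x(n := s n) \<in> box n lo hi s" using x by (auto simp: box_def)
  moreover have "lo n < x n \<and> x n < hi n" using x by (simp add: box_def)
  ultimately have "Q ((x(n := s n))(n := x n))" using * by blast
  then show "Q x" by simp
next
  fix c x assume *: "\<forall>x\<in>box (Suc n) lo hi s. Q x" and c: "lo n < c \<and> c < hi n" and x: "x \<in> box n lo hi s"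
  have "x(n := c) \<in> box (Suc n) lo hi s" using x c by (auto simp: box_def less_Suc_eq)
  then show "Q (x(n := c))" using * by blast
qed

lemma box_0: "box 0 lo hi s = {s}"
  by (auto simp: box_def)

context dp_minimal_group
begin

lemma box_nonempty:
  assumes "\<forall>i<n. lo i < hi i"
  shows "\<exists>x. x \<in> box n lo hi (s :: nat \<Rightarrow> 'a)"
proof -
  have "\<forall>i. \<exists>w. i < n \<longrightarrow> lo i < w \<and> w < hi i" using assms between by blast
  from choice[OF this] obtain w where "\<forall>i. i < n \<longrightarrow> lo i < w i \<and> w i < hi i" by blast
  then have "(\<lambda>i. if i < n then w i else s i) \<in> box n lo hi s" by (simp add: box_def)
  then show ?thesis by blast
qed

text \<open>The predicates are free of parameters and all parameters sit in \<open>s\<close> from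
  index \<open>n\<close> on, so the statement applies to every fibre of a higher-dimensional box.
  Covers suffice in place of partitions.\<close>

definition partition_prop :: "nat \<Rightarrow> bool" where
  "partition_prop n \<longleftrightarrow> (\<forall>(r::nat) P lo hi s. (\<forall>i<r. definable_pred M (P i)) \<longrightarrow> (\<forall>i<n. lo i < hi i) \<longrightarrow>
    (\<forall>x\<in>box n lo hi s. \<exists>i<r. P i x) \<longrightarrow>
    (\<exists>i<r. \<exists>lo' hi'. subbox n lo hi lo' hi' \<and> (\<forall>x\<in>box n lo' hi' s. P i x)))"

text \<open>The relation \<open>F x \<epsilon>\<close> stands for \<open>\<epsilon> < f(x)\<close>.\<close>
definition bound_prop :: "nat \<Rightarrow> bool" where
  "bound_prop n \<longleftrightarrow> (\<forall>F lo hi s. definable_rel M F \<longrightarrow> (\<forall>i<n. lo i < hi i) \<longrightarrow>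
    (\<forall>x\<in>box n lo hi s. (\<exists>\<epsilon>>0. F x \<epsilon>) \<and> (\<forall>\<epsilon> \<delta>. F x \<epsilon> \<longrightarrow> 0 < \<delta> \<longrightarrow> \<delta> \<le> \<epsilon> \<longrightarrow> F x \<delta>)) \<longrightarrow>
    (\<exists>lo' hi' \<epsilon>. subbox n lo hi lo' hi' \<and> 0 < \<epsilon> \<and> (\<forall>x\<in>box n lo' hi' s. F x \<epsilon>)))"

lemma partition_propD:
  assumes "partition_prop n" and "\<And>i. i < (r::nat) \<Longrightarrow> definable_pred M (P i)" and "\<forall>i<n. lo i < hi i"
    and "\<forall>x\<in>box n lo hi s. \<exists>i<r. P i x"
  shows "\<exists>i<r. \<exists>lo' hi'. subbox n lo hi lo' hi' \<and> (\<forall>x\<in>box n lo' hi' s. P i x)"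
proof -
  have "\<forall>i<r. definable_pred M (P i)" using assms(2) by blast
  then show ?thesis
    by (rule assms(1)[unfolded partition_prop_def, THEN spec, THEN spec, THEN spec, THEN spec, THEN spec, THEN mp, THEN mp, THEN mp, OF _ assms(3,4)])
qed

lemma bound_propD:
  assumes "bound_prop n" and "definable_rel M F" and "\<forall>i<n. lo i < hi i"
    and "\<forall>x\<in>box n lo hi s. (\<exists>\<epsilon>>0. F x \<epsilon>) \<and> (\<forall>\<epsilon> \<delta>. F x \<epsilon> \<longrightarrow> 0 < \<delta> \<longrightarrow> \<delta> \<le> \<epsilon> \<longrightarrow> F x \<delta>)"
  shows "\<exists>lo' hi' \<epsilon>. subbox n lo hi lo' hi' \<and> 0 < \<epsilon> \<and> (\<forall>x\<in>box n lo' hi' s. F x \<epsilon>)"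
  by (rule assms(1)[unfolded bound_prop_def, THEN spec, THEN spec, THEN spec, THEN spec, THEN mp, THEN mp, THEN mp, OF assms(2-4)])

lemma partition_prop_0: "partition_prop 0"
  unfolding partition_prop_def by (auto simp: box_0 subbox_def)

lemma bound_prop_0: "bound_prop 0"
  unfolding bound_prop_def by (auto simp: box_0 subbox_def)

text \<open>The values of \<open>f\<close> at finitely many points of the fibre over a small box are pushed down
  step by step, which makes the formulas \<open>\<epsilon>' < f(x, y) \<le> \<epsilon>\<close> exclusive on many intervals.\<close>
lemma bound_contradiction:
  assumes B: "bound_prop n" and F: "definable_rel M F" and proper: "\<forall>i<Suc n. lo i < hi i"
    and pos: "\<forall>x\<in>box (Suc n) lo hi s. \<exists>\<epsilon>>0. F x \<epsilon>"
    and mono: "\<forall>x\<in>box (Suc n) lo hi s. \<forall>\<epsilon> \<delta>. F x \<epsilon> \<longrightarrow> 0 < \<delta> \<longrightarrow> \<delta> \<le> \<epsilon> \<longrightarrow> F x \<delta>"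
    and small: "\<And>\<epsilon> lo' hi' u v. 0 < \<epsilon> \<Longrightarrow> subbox n lo hi lo' hi' \<Longrightarrow> lo n \<le> u \<Longrightarrow> u < v \<Longrightarrow> v \<le> hi n \<Longrightarrow>
      \<exists>lo'' hi'' c. subbox n lo' hi' lo'' hi'' \<and> u < c \<and> c < v \<and> (\<forall>x\<in>box n lo'' hi'' s. \<not> F (x(n := c)) \<epsilon>)"
  shows False
proof -
  have mono: "F (x(n := c)) \<delta>"
    if "x \<in> box n lo hi s" "lo n < c" "c < hi n" "F (x(n := c)) \<epsilon>" "0 < \<delta>" "\<delta> \<le> \<epsilon>" for x c \<epsilon> \<delta>
    using mono[unfolded box_Suc_iff, rule_format, of c x \<epsilon> \<delta>] that by blast
  \<comment> \<open>\<open>e 0\<close> and \<open>e (Suc 0)\<close> are the upper and the lower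
    bound of the value; from index 2 on, \<open>e\<close> holds a base point whose coordinate
    \<open>n\<close> is replaced by \<open>y\<close>.\<close>
  let ?\<Psi> = "\<lambda>e y. F ((\<lambda>v. e (Suc (Suc v)))(n := y)) (e (Suc 0)) \<and> \<not> F ((\<lambda>v. e (Suc (Suc v)))(n := y)) (e 0)"
  have "definable_rel M ?\<Psi>" unfolding definable_rel_def by (intro intros definable_rel_app[OF F])
  moreover have "lo n < hi n" using proper by simp
  ultimately have "\<exists>(k::nat) L R. (\<forall>i<k. lo n \<le> L i \<and> L i < R i \<and> R i \<le> hi n) \<and>
      \<not> (\<exists>b x. \<forall>i<k. \<forall>j<k. L i < x i j \<and> x i j < R i \<and> (\<forall>l<k. ?\<Psi> (b l) (x i j) \<longleftrightarrow> l = j))"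
    by (rule no_interval_pattern)
  then obtain k :: nat and L R where LR_no: "(\<forall>i<k. lo n \<le> L i \<and> L i < R i \<and> R i \<le> hi n) \<and>
      \<not> (\<exists>b x. \<forall>i<k. \<forall>j<k. L i < x i j \<and> x i j < R i \<and> (\<forall>l<k. ?\<Psi> (b l) (x i j) \<longleftrightarrow> l = j))"
    by (elim exE)
  note LR = LR_no[THEN conjunct1] and no = LR_no[THEN conjunct2]
  \<comment> \<open>One round: in each interval a height is found at which the values over a smaller
    box have dropped to at most \<open>\<epsilon>\<close> but still exceed a common
    \<open>\<delta>\<close>.\<close>
  have step: "\<exists>lo'' hi'' \<delta> c. subbox n lo' hi' lo'' hi'' \<and> 0 < \<delta> \<and> \<delta> \<le> \<epsilon> \<and>
      (\<forall>i<m. L i < c i \<and> c i < R i \<and> (\<forall>x\<in>box n lo'' hi'' s. F (x(n := c i)) \<delta> \<and> \<not> F (x(n := c i)) \<epsilon>))"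
    if sub: "subbox n lo hi lo' hi'" and \<epsilon>: "0 < \<epsilon>" and "m \<le> k" for lo' hi' \<epsilon> m
    using \<open>m \<le> k\<close>
  proof (induction m)
    case 0
    show ?case using subbox_refl[OF subbox_proper[OF sub]] \<epsilon> by (intro exI[of _ lo'] exI[of _ hi'] exI[of _ \<epsilon>]) simp
  next
    case (Suc m)
    from Suc.IH[OF Suc_leD[OF Suc.prems]]
    obtain lo1 hi1 \<delta> c where 1: "subbox n lo' hi' lo1 hi1" "0 < \<delta>" "\<delta> \<le> \<epsilon>" and
      c: "\<forall>i<m. L i < c i \<and> c i < R i \<and> (\<forall>x\<in>box n lo1 hi1 s. F (x(n := c i)) \<delta> \<and> \<not> F (x(n := c i)) \<epsilon>)" by blast
    have sub1: "subbox n lo hi lo1 hi1" by (rule subbox_trans[OF sub 1(1)])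
    have "m < k" using Suc.prems by simp
    then have LRm: "lo n \<le> L m" "L m < R m" "R m \<le> hi n" using LR by auto
    from small[OF \<epsilon> sub1 this] obtain lo2 hi2 d where 2: "subbox n lo1 hi1 lo2 hi2" "L m < d" "d < R m"
      "\<forall>x\<in>box n lo2 hi2 s. \<not> F (x(n := d)) \<epsilon>" by blast
    have sub2: "subbox n lo hi lo2 hi2" by (rule subbox_trans[OF sub1 2(1)])
    have d: "lo n < d" "d < hi n" using LRm 2 by auto
    have "\<forall>x\<in>box n lo2 hi2 (s(n := d)). (\<exists>\<epsilon>>0. F x \<epsilon>) \<and> (\<forall>\<epsilon> \<delta>. F x \<epsilon> \<longrightarrow> 0 < \<delta> \<longrightarrow> \<delta> \<le> \<epsilon> \<longrightarrow> F x \<delta>)"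
      unfolding box_update_param
    proof
      fix x assume "x \<in> box n lo2 hi2 s"
      then have x: "x \<in> box n lo hi s" by (rule box_mono[OF sub2])
      then have "\<exists>\<epsilon>>0. F (x(n := d)) \<epsilon>" using pos[unfolded box_Suc_iff] d by blast
      then show "(\<exists>\<epsilon>>0. F (x(n := d)) \<epsilon>) \<and> (\<forall>\<epsilon> \<delta>. F (x(n := d)) \<epsilon> \<longrightarrow> 0 < \<delta> \<longrightarrow> \<delta> \<le> \<epsilon> \<longrightarrow> F (x(n := d)) \<delta>)"
        using mono[OF x d] by blast
    qed
    \<comment> \<open>At the fixed height \<open>d\<close> the base has dimension \<open>n\<close>,
      so the inductive bound gives a positive lower bound after shrinking the box. Taking
      \<open>min \<delta> \<eta>\<close> below keeps the bounds of the earlier heights.\<close>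
    from bound_propD[OF B F subbox_proper[OF 2(1)] this] obtain lo3 hi3 \<eta> where
      3: "subbox n lo2 hi2 lo3 hi3" "0 < \<eta>" "\<forall>x\<in>box n lo3 hi3 (s(n := d)). F x \<eta>" by blast
    have F\<eta>: "\<forall>x\<in>box n lo3 hi3 s. F (x(n := d)) \<eta>" using 3(3) unfolding box_update_param .
    have sub3: "subbox n lo hi lo3 hi3" by (rule subbox_trans[OF sub2 3(1)])
    have 4: "subbox n lo' hi' lo3 hi3" by (rule subbox_trans[OF subbox_trans[OF 1(1) 2(1)] 3(1)])
    have 5: "0 < min \<delta> \<eta>" "min \<delta> \<eta> \<le> \<epsilon>" using 1 3 by (auto simp: min.coboundedI1)
    have 6: "\<forall>i<Suc m. L i < (c(m := d)) i \<and> (c(m := d)) i < R i \<and>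
        (\<forall>x\<in>box n lo3 hi3 s. F (x(n := (c(m := d)) i)) (min \<delta> \<eta>) \<and> \<not> F (x(n := (c(m := d)) i)) \<epsilon>)"
    proof (intro allI impI, goal_cases)
      case i: (1 i)
      show ?case
      proof (cases "i = m")
        case True
        have "F (x(n := d)) (min \<delta> \<eta>) \<and> \<not> F (x(n := d)) \<epsilon>" if x: "x \<in> box n lo3 hi3 s" for x
        proof
          show "F (x(n := d)) (min \<delta> \<eta>)"
            by (rule mono[OF box_mono[OF sub3 x] d F\<eta>[rule_format, OF x]]) (use \<open>0 < min \<delta> \<eta>\<close> in simp_all)
          show "\<not> F (x(n := d)) \<epsilon>" using 2(4) box_mono[OF 3(1) x] by blast
        qed
        with True 2 show ?thesis by simp
      next
        case False
        then have im: "i < m" using i by simp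
        then have ci: "L i < c i" "c i < R i" using c by auto
        have "i < k" using im \<open>m < k\<close> by simp
        then have cb: "lo n < c i" "c i < hi n" using LR ci by (meson order_le_less_trans order_less_le_trans)+
        have "F (x(n := c i)) (min \<delta> \<eta>) \<and> \<not> F (x(n := c i)) \<epsilon>" if x: "x \<in> box n lo3 hi3 s" for x
        proof -
          have x1: "x \<in> box n lo1 hi1 s" by (rule box_mono[OF subbox_trans[OF 2(1) 3(1)] x])
          then have "F (x(n := c i)) \<delta>" "\<not> F (x(n := c i)) \<epsilon>" using c im by auto
          then show ?thesis using mono[OF box_mono[OF sub3 x] cb, of \<delta> "min \<delta> \<eta>"] \<open>0 < min \<delta> \<eta>\<close> by simp
        qed
        with False ci show ?thesis by simp
      qed
    qed
    show ?case
      by (rule exI[of _ lo3], rule exI[of _ hi3], rule exI[of _ "min \<delta> \<eta>"], rule exI[of _ "c(m := d)"])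
        (intro conjI 4 5 6)
  qed
  obtain \<epsilon>0 :: 'a where \<epsilon>0: "\<epsilon>0 > 0" using ex_pos by blast
  \<comment> \<open>Each round starts from the lower bound of the previous one. The values found in
    round \<open>j\<close> thus lie above \<open>e (Suc j)\<close> and not above \<open>e j\<close>,
    and these ranges are disjoint for different rounds.\<close>
  have iter: "\<exists>lo' hi' (e :: nat \<Rightarrow> 'a) c. subbox n lo hi lo' hi' \<and> (\<forall>j\<le>m. 0 < e j) \<and> (\<forall>j<m. e (Suc j) \<le> e j) \<and>
      (\<forall>j<m. \<forall>i<k. L i < c j i \<and> c j i < R i \<and>
        (\<forall>x\<in>box n lo' hi' s. F (x(n := c j i)) (e (Suc j)) \<and> \<not> F (x(n := c j i)) (e j)))" for m
  proof (induction m)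
    case 0
    have "subbox n lo hi lo hi" using proper by (intro subbox_refl) simp
    then show ?case using \<epsilon>0 by (intro exI[of _ lo] exI[of _ hi] exI[of _ "\<lambda>_. \<epsilon>0"]) simp
  next
    case (Suc m)
    then obtain lo1 hi1 and e :: "nat \<Rightarrow> 'a" and c where
      IH: "subbox n lo hi lo1 hi1 \<and> (\<forall>j\<le>m. 0 < e j) \<and> (\<forall>j<m. e (Suc j) \<le> e j) \<and>
        (\<forall>j<m. \<forall>i<k. L i < c j i \<and> c j i < R i \<and>
          (\<forall>x\<in>box n lo1 hi1 s. F (x(n := c j i)) (e (Suc j)) \<and> \<not> F (x(n := c j i)) (e j)))" by (elim exE)
    note 1 = IH[THEN conjunct1] IH[THEN conjunct2, THEN conjunct1] IH[THEN conjunct2, THEN conjunct2, THEN conjunct1]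
      and c = IH[THEN conjunct2, THEN conjunct2, THEN conjunct2]
    have "0 < e m" using 1(2) by simp
    from step[OF 1(1) this order_refl] obtain lo2 hi2 \<delta> d where 2: "subbox n lo1 hi1 lo2 hi2" "0 < \<delta>" "\<delta> \<le> e m"
      and d: "\<forall>i<k. L i < d i \<and> d i < R i \<and> (\<forall>x\<in>box n lo2 hi2 s. F (x(n := d i)) \<delta> \<and> \<not> F (x(n := d i)) (e m))" by blast
    let ?e = "e(Suc m := \<delta>)" and ?c = "c(m := d)"
    have 3: "subbox n lo hi lo2 hi2" by (rule subbox_trans[OF 1(1) 2(1)])
    have 4: "\<forall>j\<le>Suc m. 0 < ?e j" using 1(2) 2(2) by (simp add: le_Suc_eq)
    have 5: "\<forall>j<Suc m. ?e (Suc j) \<le> ?e j" using 1(3) 2(3) by (auto simp: less_Suc_eq)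
    have 6: "\<forall>j<Suc m. \<forall>i<k. L i < ?c j i \<and> ?c j i < R i \<and>
        (\<forall>x\<in>box n lo2 hi2 s. F (x(n := ?c j i)) (?e (Suc j)) \<and> \<not> F (x(n := ?c j i)) (?e j))"
    proof (intro allI impI, goal_cases)
      case ji: (1 j i)
      show ?case
      proof (cases "j = m")
        case True
        then show ?thesis using d ji by simp
      next
        case False
        then have "j < m" using ji by simp
        then have *: "L i < c j i \<and> c j i < R i \<and>
          (\<forall>x\<in>box n lo1 hi1 s. F (x(n := c j i)) (e (Suc j)) \<and> \<not> F (x(n := c j i)) (e j))" using c ji(2) by blast
        then have "L i < c j i \<and> c j i < R i \<and>
          (\<forall>x\<in>box n lo2 hi2 s. F (x(n := c j i)) (e (Suc j)) \<and> \<not> F (x(n := c j i)) (e j))" using box_mono[OF 2(1)] by blast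
        then show ?thesis using \<open>j < m\<close> by simp
      qed
    qed
    show ?case
      by (rule exI[of _ lo2], rule exI[of _ hi2], rule exI[of _ ?e], rule exI[of _ ?c]) (intro conjI 3 4 5 6)
  qed
  from iter[of k] obtain lo' hi' and e :: "nat \<Rightarrow> 'a" and c where
    iter_k: "subbox n lo hi lo' hi' \<and> (\<forall>j\<le>k. 0 < e j) \<and> (\<forall>j<k. e (Suc j) \<le> e j) \<and>
      (\<forall>j<k. \<forall>i<k. L i < c j i \<and> c j i < R i \<and>
        (\<forall>x\<in>box n lo' hi' s. F (x(n := c j i)) (e (Suc j)) \<and> \<not> F (x(n := c j i)) (e j)))" by (elim exE)
  note sub = iter_k[THEN conjunct1] and e = iter_k[THEN conjunct2, THEN conjunct1] iter_k[THEN conjunct2, THEN conjunct2, THEN conjunct1]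
    and c = iter_k[THEN conjunct2, THEN conjunct2, THEN conjunct2]
  \<comment> \<open>The boxes are nested, so one base point serves the heights of all rounds and the
    whole pattern lies in a single fibre.\<close>
  obtain x where x: "x \<in> box n lo' hi' s" using box_nonempty[OF subbox_proper[OF sub]] by blast
  have anti: "e j \<le> e i" if "i \<le> j" "j \<le> k" for i j
    using that
  proof (induction j rule: dec_induct)
    case (step m)
    then have "e (Suc m) \<le> e m" "e m \<le> e i" using e(2) by auto
    then show ?case by (rule order_trans)
  qed simp
  have \<Psi>: "?\<Psi> (case_nat (e l) (case_nat (e (Suc l)) x)) (c j i) \<longleftrightarrow> l = j" if ijl: "i < k" "j < k" "l < k" for i j l
  proof -
    have cji: "L i < c j i" "c j i < R i" "F (x(n := c j i)) (e (Suc j))" "\<not> F (x(n := c j i)) (e j)"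
      using c ijl x by auto
    have cb: "lo n < c j i" "c j i < hi n" using LR cji ijl by (meson order_le_less_trans order_less_le_trans)+
    note mono' = mono[OF box_mono[OF sub x] cb]
    consider "l < j" | "l = j" | "j < l" by linarith
    then have "F (x(n := c j i)) (e (Suc l)) \<and> \<not> F (x(n := c j i)) (e l) \<longleftrightarrow> l = j"
    proof cases
      case 1
      then have "e j \<le> e (Suc l)" "0 < e j" using anti[of "Suc l" j] ijl e(1) by auto
      then have "\<not> F (x(n := c j i)) (e (Suc l))" using mono' cji by blast
      with 1 show ?thesis by simp
    next
      case 2
      then show ?thesis using cji by simp
    next
      case 3
      then have "e l \<le> e (Suc j)" "0 < e l" using anti[of "Suc j" l] ijl e(1) by auto
      then have "F (x(n := c j i)) (e l)" using mono' cji by blast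
      with 3 show ?thesis by simp
    qed
    then show ?thesis by simp
  qed
  have LRc: "L i < c j i \<and> c j i < R i" if "i < k" "j < k" for i j using c that by blast
  show False
    by (rule notE[OF no], rule exI[of _ "\<lambda>l. case_nat (e l) (case_nat (e (Suc l)) x)"], rule exI[of _ "\<lambda>i j. c j i"])
      (intro allI impI conjI, erule (1) LRc[THEN conjunct1], erule (1) LRc[THEN conjunct2], rule \<Psi>, assumption+)
qed

text \<open>The extra parameter \<open>e\<close> is inserted at index \<open>n\<close> and the
  entries of \<open>s\<close> move up by one; \<open>?d\<close> deletes it again. This makes
  instances of a relation accessible to \<open>partition_prop\<close>, which speaks of predicates of
  assignments only.\<close>

lemma partition_prop_param:
  assumes A: "partition_prop n" and Q: "\<And>i. i < (r::nat) \<Longrightarrow> definable_rel M (Q i)" and proper: "\<forall>i<n. lo i < hi i"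
    and cover: "\<forall>x\<in>box n lo hi s. \<exists>i<r. Q i x e"
  shows "\<exists>i<r. \<exists>lo' hi'. subbox n lo hi lo' hi' \<and> (\<forall>x\<in>box n lo' hi' s. Q i x e)"
proof -
  let ?d = "\<lambda>y v. if v < n then y v else y (Suc v)"
  let ?s = "\<lambda>v. if v = n then e else s (v - 1)"
  have eq: "(\<forall>y\<in>box n lo hi ?s. R (?d y) (y n)) \<longleftrightarrow> (\<forall>x\<in>box n lo hi s. R x e)" for R lo hi
  proof (intro iffI ballI)
    fix x assume *: "\<forall>y\<in>box n lo hi ?s. R (?d y) (y n)" and x: "x \<in> box n lo hi s"
    let ?y = "\<lambda>v. if v < n then x v else ?s v"
    have y: "?y \<in> box n lo hi ?s" using x by (simp add: box_def)
    have "R (?d ?y) (?y n)" by (rule bspec[OF * y])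
    moreover have "?d ?y = x" using x by (auto simp: box_def fun_eq_iff)
    ultimately show "R x e" by simp
  next
    fix y assume *: "\<forall>x\<in>box n lo hi s. R x e" and y: "y \<in> box n lo hi ?s"
    have "?d y \<in> box n lo hi s" using y by (simp add: box_def)
    moreover have "y n = e" using y by (simp add: box_def)
    ultimately show "R (?d y) (y n)" using * by simp
  qed
  have "\<forall>y\<in>box n lo hi ?s. \<exists>i<r. Q i (?d y) (y n)"
    using cover unfolding eq[of lo hi "\<lambda>x e. \<exists>i<r. Q i x e"] .
  moreover have "definable_pred M (\<lambda>y. Q i (?d y) (y n))" if "i < r" for i
  proof (rule definable_rel_app[OF Q[OF that] _ definable_term_var])
    show "definable_term M (\<lambda>y. ?d y v)" for v by (cases "v < n") (simp_all add: definable_term_var)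
  qed
  ultimately have "\<exists>i<r. \<exists>lo' hi'. subbox n lo hi lo' hi' \<and> (\<forall>y\<in>box n lo' hi' ?s. Q i (?d y) (y n))"
    using partition_propD[OF A _ proper, of r "\<lambda>i y. Q i (?d y) (y n)" ?s] by blast
  then obtain i lo' hi' where 1: "i < r" "subbox n lo hi lo' hi'" "\<forall>y\<in>box n lo' hi' ?s. Q i (?d y) (y n)" by blast
  have "\<forall>x\<in>box n lo' hi' s. Q i x e" by (rule iffD1[OF eq[of lo' hi' "Q i"] 1(3)])
  with 1 show ?thesis by blast
qed

text \<open>If no bound holds on any subbox, then for each \<open>\<epsilon>\<close> the partition
  by \<open>F x \<epsilon>\<close> must yield a subbox on which it fails, as
  \<open>bound_contradiction\<close> demands. For \<open>n = 0\<close> the base is a point and a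
  single failure is enough.\<close>

lemma bound_prop_Suc:
  assumes B: "bound_prop n" and A: "n = 0 \<or> partition_prop (Suc n)"
  shows "bound_prop (Suc n)"
  unfolding bound_prop_def
proof (intro allI impI, rule ccontr)
  fix F and lo hi s :: "nat \<Rightarrow> 'a"
  assume F: "definable_rel M F" and proper: "\<forall>i<Suc n. lo i < hi i"
    and posmono: "\<forall>x\<in>box (Suc n) lo hi s. (\<exists>\<epsilon>>0. F x \<epsilon>) \<and> (\<forall>\<epsilon> \<delta>. F x \<epsilon> \<longrightarrow> 0 < \<delta> \<longrightarrow> \<delta> \<le> \<epsilon> \<longrightarrow> F x \<delta>)"
    and contra: "\<not> (\<exists>lo' hi' \<epsilon>. subbox (Suc n) lo hi lo' hi' \<and> 0 < \<epsilon> \<and> (\<forall>x\<in>box (Suc n) lo' hi' s. F x \<epsilon>))"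
  show False
  proof (rule bound_contradiction[OF B F proper])
    show "\<forall>x\<in>box (Suc n) lo hi s. \<exists>\<epsilon>>0. F x \<epsilon>" using posmono by blast
    show "\<forall>x\<in>box (Suc n) lo hi s. \<forall>\<epsilon> \<delta>. F x \<epsilon> \<longrightarrow> 0 < \<delta> \<longrightarrow> \<delta> \<le> \<epsilon> \<longrightarrow> F x \<delta>" using posmono by blast
    fix \<epsilon> u v :: 'a and lo' hi' :: "nat \<Rightarrow> 'a"
    assume \<epsilon>: "0 < \<epsilon>" and sub: "subbox n lo hi lo' hi'" and uv: "lo n \<le> u" "u < v" "v \<le> hi n"
    let ?lo = "lo'(n := u)" and ?hi = "hi'(n := v)"
    have sub': "subbox (Suc n) lo hi ?lo ?hi" using sub uv by (simp add: subbox_def less_Suc_eq)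
    have notall: "\<not> (\<forall>x\<in>box (Suc n) lo1 hi1 s. F x \<epsilon>)" if "subbox (Suc n) ?lo ?hi lo1 hi1" for lo1 hi1
      using contra subbox_trans[OF sub' that] \<epsilon> by blast
    show "\<exists>lo'' hi'' c. subbox n lo' hi' lo'' hi'' \<and> u < c \<and> c < v \<and> (\<forall>x\<in>box n lo'' hi'' s. \<not> F (x(n := c)) \<epsilon>)"
      using A
    proof
      assume n: "n = 0"
      have "\<not> (\<forall>x\<in>box (Suc n) ?lo ?hi s. F x \<epsilon>)" by (rule notall[OF subbox_refl[OF subbox_proper[OF sub']]])
      then obtain c where "u < c" "c < v" "\<not> F (s(n := c)) \<epsilon>" unfolding box_Suc_iff n box_0 by auto
      then show ?thesis unfolding n box_0 by (intro exI[of _ lo'] exI[of _ hi'] exI[of _ c]) (simp add: subbox_def n)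
    next
      assume A: "partition_prop (Suc n)"
      let ?Q = "\<lambda>i x e. if i = (0::nat) then F x e else \<not> F x e"
      have "definable_rel M (?Q i)" for i
        by (cases "i = 0") (use F in \<open>simp_all add: definable_rel_def definable_pred_Not\<close>)
      moreover have "\<forall>x\<in>box (Suc n) ?lo ?hi s. \<exists>i<2. ?Q i x \<epsilon>"
      proof
        fix x
        show "\<exists>i<2. ?Q i x \<epsilon>" by (cases "F x \<epsilon>") (force intro: exI[of _ 0], force intro: exI[of _ 1])
      qed
      ultimately obtain i lo1 hi1 where 1: "i < 2" "subbox (Suc n) ?lo ?hi lo1 hi1" "\<forall>x\<in>box (Suc n) lo1 hi1 s. ?Q i x \<epsilon>"
        using partition_prop_param[OF A _ subbox_proper[OF sub'], of 2 ?Q s \<epsilon>] by blast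
      have "i \<noteq> 0"
      proof
        assume "i = 0"
        then have "\<forall>x\<in>box (Suc n) lo1 hi1 s. F x \<epsilon>" using 1(3) by simp
        then show False using notall[OF 1(2)] by blast
      qed
      then have notF: "\<forall>x\<in>box (Suc n) lo1 hi1 s. \<not> F x \<epsilon>" using 1(3) by simp
      have "lo1 n < hi1 n" "u \<le> lo1 n" "hi1 n \<le> v" using 1(2) by (auto simp: subbox_def dest: spec[of _ n])
      then obtain c where c: "lo1 n < c" "c < hi1 n" "u < c" "c < v" using between by (meson order_le_less_trans order_less_le_trans)
      have "subbox n lo' hi' lo1 hi1" using 1(2) by (auto simp: subbox_def less_Suc_eq)
      moreover have "\<forall>x\<in>box n lo1 hi1 s. \<not> F (x(n := c)) \<epsilon>" using notF c unfolding box_Suc_iff by blast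
      ultimately show ?thesis using c by blast
    qed
  qed
qed

end

section \<open>Partitions of intervals\<close>

context dp_minimal_group
begin

text \<open>A class that is not dense leaves a gap, and inside the gap the remaining classes still
  cover; classes are discarded until a dense one is met.\<close>

lemma finite_cover_dense:
  assumes "finite S" and "(u::'a) < v" and "\<forall>y. u < y \<longrightarrow> y < v \<longrightarrow> (\<exists>a\<in>S. C a y)"
  shows "\<exists>a\<in>S. \<exists>u' v'. u \<le> u' \<and> u' < v' \<and> v' \<le> v \<and>
    (\<forall>p q. u' \<le> p \<longrightarrow> p < q \<longrightarrow> q \<le> v' \<longrightarrow> (\<exists>y. p < y \<and> y < q \<and> C a y))"
  using assms
proof (induction S arbitrary: u v rule: finite_induct)
  case empty
  then show ?case using between by blast
next
  case (insert a S)
  show ?case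
  proof (cases "\<forall>p q. u \<le> p \<longrightarrow> p < q \<longrightarrow> q \<le> v \<longrightarrow> (\<exists>y. p < y \<and> y < q \<and> C a y)")
    case True
    then show ?thesis using insert.prems(1) by blast
  next
    case False
    then obtain p q where pq: "u \<le> p" "p < q" "q \<le> v" "\<forall>y. p < y \<longrightarrow> y < q \<longrightarrow> \<not> C a y" by blast
    have "\<exists>a\<in>S. C a y" if "p < y" "y < q" for y
    proof -
      have "u < y" "y < v" using that pq by auto
      then obtain b where "b \<in> insert a S" "C b y" using insert.prems(2) by blast
      then show ?thesis using pq(4) that by blast
    qed
    then have "\<forall>y. p < y \<longrightarrow> y < q \<longrightarrow> (\<exists>a\<in>S. C a y)" by blast
    from insert.IH[OF pq(2) this] obtain b u' v' where "b \<in> S" "p \<le> u'" "u' < v'" "v' \<le> q"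
      "\<forall>p q. u' \<le> p \<longrightarrow> p < q \<longrightarrow> q \<le> v' \<longrightarrow> (\<exists>y. p < y \<and> y < q \<and> C b y)" by blast
    moreover have "u \<le> u'" "v' \<le> v" using pq calculation by auto
    ultimately show ?thesis by blast
  qed
qed

lemma ex_half: "(0::'a) < d \<Longrightarrow> \<exists>h>0. h + h < d"
proof -
  assume "0 < d"
  then obtain m where m: "0 < m" "m < d" using between by blast
  obtain h where h: "h + h = m" using divisible[of 2 m] by (auto simp: numeral_2_eq_2)
  have "h > 0" using h m(1) by (metis add_nonpos_nonpos leD not_less)
  then show ?thesis using h m by blast
qed

text \<open>A set of pairwise inequivalent points of greatest size exists by the bound on germs, and
  it meets every class.\<close>

lemma finite_germ_representatives:
  assumes X: "definable_rel M X"
  shows "\<exists>S. finite S \<and> (\<forall>y. \<exists>a\<in>S. germ_eq (X s) a y)"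
proof -
  obtain K where K: "\<And>A. finite A \<Longrightarrow> K < card A \<Longrightarrow> \<exists>a\<in>A. \<exists>b\<in>A. a \<noteq> b \<and> germ_eq (X s) a b"
    using finite_germs[OF X, of s] by blast
  let ?P = "\<lambda>S. finite S \<and> (\<forall>a\<in>S. \<forall>b\<in>S. a \<noteq> b \<longrightarrow> \<not> germ_eq (X s) a b)"
  have "?P {}" by simp
  moreover have "\<forall>S. ?P S \<longrightarrow> card S < Suc K"
  proof (intro allI impI, rule ccontr)
    fix S assume "?P S" "\<not> card S < Suc K"
    then show False using K[of S] by auto
  qed
  ultimately have "\<exists>S. ?P S \<and> (\<forall>S'. ?P S' \<longrightarrow> card S' \<le> card S)"
    by (rule ex_has_greatest_nat[of ?P "{}" card "Suc K"])
  then obtain S where S_max: "?P S \<and> (\<forall>S'. ?P S' \<longrightarrow> card S' \<le> card S)" by (rule exE)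
  note S = S_max[THEN conjunct1] and max = S_max[THEN conjunct2, rule_format]
  have "\<exists>a\<in>S. germ_eq (X s) a y" for y
  proof (rule ccontr)
    assume *: "\<not> ?thesis"
    have "germ_eq (X s) y y" using ex_pos by (auto simp: germ_eq_def near_def)
    then have "y \<notin> S" using * by blast
    moreover have "?P (insert y S)" using S * germ_eq_sym by blast
    ultimately show False using max[of "insert y S"] S by simp
  qed
  with S show ?thesis by blast
qed

lemma sum_const_add: "(\<Sum>j<i + k. z) = (\<Sum>j<i. z) + (\<Sum>j<k. z :: 'a)" for i k :: nat
  by (induction k) (simp_all add: add.assoc)

lemma sum_const_mono:
  assumes "(0::'a) \<le> z" and "i \<le> (k::nat)"
  shows "(\<Sum>j<i. z) \<le> (\<Sum>j<k. z)"
  by (rule sum_mono2) (use assms in auto)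

lemma sum_const_strict_mono:
  assumes "(0::'a) < z" and "i < (k::nat)"
  shows "(\<Sum>j<i. z) < (\<Sum>j<k. z)"
proof -
  have "(\<Sum>j<i. z) < (\<Sum>j<Suc i. z)" using assms by simp
  also have "\<dots> \<le> (\<Sum>j<k. z)" by (rule sum_const_mono) (use assms in auto)
  finally show ?thesis .
qed

text \<open>On a small interval the points with the germ of \<open>p\<close> form a dense local subgroup of finite
  index, which is everything by divisibility.\<close>
lemma interval_dichotomy:
  assumes X: "definable_rel M X" and uv: "u < v"
  shows "\<exists>u' v'. u \<le> u' \<and> u' < v' \<and> v' \<le> v \<and>
    ((\<forall>y. u' < y \<longrightarrow> y < v' \<longrightarrow> X s y) \<or> (\<forall>y. u' < y \<longrightarrow> y < v' \<longrightarrow> \<not> X s y))"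
proof -
  let ?Y = "X s"
  obtain S where "finite S" "\<forall>y. \<exists>a\<in>S. germ_eq ?Y a y" using finite_germ_representatives[OF X] by blast
  then obtain a u1 v1 where 1: "u \<le> u1" "u1 < v1" "v1 \<le> v"
    and dense1: "\<forall>p q. u1 \<le> p \<longrightarrow> p < q \<longrightarrow> q \<le> v1 \<longrightarrow> (\<exists>y. p < y \<and> y < q \<and> germ_eq ?Y a y)"
    using finite_cover_dense[of S u v "germ_eq ?Y"] uv by blast
  \<comment> \<open>This encodes the radius up to which the germs at \<open>x 0\<close> and at
    \<open>a = x (Suc 0)\<close> agree, with every radius allowed outside the class of
    \<open>a\<close>. The bound in dimension one makes it uniform.\<close>
  let ?F = "\<lambda>x \<epsilon>. near (X (\<lambda>v. x (Suc (Suc v)))) \<epsilon> (x (Suc 0)) (x 0) \<or> \<not> germ_eq (X (\<lambda>v. x (Suc (Suc v)))) (x (Suc 0)) (x 0)"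
  have F: "definable_rel M ?F" unfolding definable_rel_def germ_eq_def near_def by (intro intros definable_rel_app[OF X])
  let ?s = "case_nat undefined (case_nat a s)"
  have "\<forall>x\<in>box (Suc 0) (\<lambda>_. u1) (\<lambda>_. v1) ?s.
      (\<exists>\<epsilon>>0. ?F x \<epsilon>) \<and> (\<forall>\<epsilon> \<delta>. ?F x \<epsilon> \<longrightarrow> 0 < \<delta> \<longrightarrow> \<delta> \<le> \<epsilon> \<longrightarrow> ?F x \<delta>)"
  proof (intro ballI conjI allI impI)
    fix x show "\<exists>\<epsilon>>0. ?F x \<epsilon>" using ex_pos unfolding germ_eq_def by blast
  next
    fix x \<epsilon> \<delta> assume "?F x \<epsilon>" "\<delta> \<le> \<epsilon>"
    then show "?F x \<delta>" using near_mono by blast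
  qed
  then obtain lo hi \<epsilon> where 2: "subbox (Suc 0) (\<lambda>_. u1) (\<lambda>_. v1) lo hi" "0 < \<epsilon>"
    and near2: "\<forall>x\<in>box (Suc 0) lo hi ?s. ?F x \<epsilon>"
    using bound_propD[OF bound_prop_Suc[OF bound_prop_0] F, of "\<lambda>_. u1" "\<lambda>_. v1" ?s] 1(2) by auto
  define u2 v2 where "u2 = lo 0" and "v2 = hi 0"
  have uv2: "u1 \<le> u2" "u2 < v2" "v2 \<le> v1" using 2(1) by (auto simp: subbox_def u2_def v2_def)
  have near_a: "near ?Y \<epsilon> a c" if "u2 < c" "c < v2" "germ_eq ?Y a c" for c
    using near2 that unfolding box_Suc_iff box_0 by (auto simp: u2_def v2_def)
  have dense: "\<exists>y. p < y \<and> y < q \<and> germ_eq ?Y a y" if "u2 \<le> p" "p < q" "q \<le> v2" for p q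
    using dense1 that uv2 by (meson order_trans)
  obtain p where p: "u2 < p" "p < v2" "germ_eq ?Y a p" using dense[OF order_refl uv2(2) order_refl] by blast
  have "0 < min \<epsilon> (min (v2 - p) (p - u2))" using 2(2) p by simp
  \<comment> \<open>The window \<open>I\<close> has radius \<open>h + h\<close>, so that it contains
    sums of two offsets from 0 up to \<open>h\<close>, while \<open>p\<close> plus the window stays
    in the interval and offsets stay below the radius \<open>\<epsilon>\<close>.\<close>
  then obtain h where h: "0 < h" "h + h < min \<epsilon> (min (v2 - p) (p - u2))" using ex_half by blast
  have he: "h + h < \<epsilon>" "p + (h + h) < v2" "u2 < p - (h + h)" using h(2) by (simp_all add: algebra_simps)
  define D where "D x = germ_eq ?Y a (p + x)" for x
  define I where "I x \<longleftrightarrow> - (h + h) < x \<and> x < h + h" for x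
  have I_uv: "u2 < p + x \<and> p + x < v2" if "I x" for x
  proof -
    have "p + (- (h + h)) < p + x" "p + x < p + (h + h)" using that by (simp_all only: I_def add_less_cancel_left)
    moreover have "u2 < p + (- (h + h))" using he(3) by (simp only: add_uminus_conv_diff)
    ultimately show ?thesis using he(2) less_trans by blast
  qed
  have I_eps: "- \<epsilon> < x \<and> x < \<epsilon>" if "I x" for x
  proof -
    have "- \<epsilon> < - (h + h)" using he(1) by (simp only: neg_less_iff_less)
    then show ?thesis using that he(1) unfolding I_def by (meson less_trans)
  qed
  have near_p: "near ?Y \<epsilon> p (p + x)" if "I x" "D x" for x
    using near_a[of "p + x"] near_a[OF p] I_uv[OF that(1)] that(2) unfolding D_def
    by (blast intro: near_sym near_trans)
  \<comment> \<open>Agreement of \<open>?Y\<close> around \<open>p\<close> and \<open>p + x\<close>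
    up to \<open>\<epsilon>\<close> also identifies the germs at \<open>p + y\<close> and
    \<open>p + (x + y)\<close>. So \<open>D\<close> is invariant under translation by its own
    members, which yields closure under negation and addition.\<close>
  have inv: "D y \<longleftrightarrow> D (x + y)" if x: "I x" "D x" and y: "- \<epsilon> < y" "y < \<epsilon>" for x y
  proof -
    have "germ_eq ?Y (p + y) (p + (x + y))"
    proof (cases "y = 0")
      case True
      then show ?thesis using near_p[OF x] 2(2) by (auto simp: germ_eq_def)
    next
      case False
      \<comment> \<open>This radius keeps \<open>y + t\<close> inside the range of agreement and off
        0, where punctured germs say nothing.\<close>
      let ?\<delta> = "min (max y (- y)) (min (\<epsilon> - y) (y + \<epsilon>))"
      have "0 < max y (- y)" using False by (auto simp: less_max_iff_disj)
      then have "0 < ?\<delta>" using y by (simp add: less_diff_eq minus_less_iff) (metis add.commute add_less_cancel_left add.right_inverse y(1))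
      moreover have "near ?Y ?\<delta> (p + y) (p + (x + y))"
        unfolding near_def
      proof (intro allI impI)
        fix t assume t: "- ?\<delta> < t" "t < ?\<delta>"
        have "t < \<epsilon> - y" using t(2) by simp
        then have t1: "y + t < \<epsilon>" by (simp add: algebra_simps)
        have "- t < y + \<epsilon>" using t(1) by (simp add: minus_less_iff)
        from add_strict_right_mono[OF this, of "t - \<epsilon>"] have t2: "- \<epsilon> < y + t" by (simp add: algebra_simps)
        have "y + t \<noteq> 0"
        proof
          assume "y + t = 0"
          then have "t = - y" by (simp add: add_eq_0_iff)
          with t show False by (auto simp: less_max_iff_disj min_less_iff_disj)
        qed
        then have "?Y (p + (y + t)) = ?Y ((p + x) + (y + t))"
          using near_p[OF x] t1 t2 unfolding near_def by blast
        then show "?Y (p + y + t) = ?Y (p + (x + y) + t)" by (simp add: ac_simps)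
      qed
      ultimately show ?thesis unfolding germ_eq_def by blast
    qed
    then show ?thesis unfolding D_def using germ_eq_trans germ_eq_sym by blast
  qed
  have D0: "D 0" using p(3) by (simp add: D_def)
  have D_neg: "D (- x)" if "I x" "D x" for x
    using inv[OF that, of "- x"] I_eps[OF that(1)] D0 by (simp add: minus_less_iff)
  have D_add: "D (x + y)" if "I x" "D x" "I y" "D y" for x y
    using inv[OF that(1,2), of y] I_eps[OF that(3)] that(4) by blast
  have I_neg: "I (- x)" if "I x" for x
    using that unfolding I_def neg_less_iff_less minus_less_iff[of x] by blast
  have D_diff: "D (x - y)" if "I x" "D x" "I y" "D y" for x y
    using D_add[OF that(1,2) I_neg[OF that(3)] D_neg[OF that(3,4)]] by simp
  have I_pos: "I x" if "0 \<le> x" "x < h + h" for x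
  proof -
    have "- (h + h) < 0" using h(1) by (simp add: add_pos_pos)
    then show ?thesis using that unfolding I_def by (blast intro: order_less_le_trans)
  qed
  have hh: "h < h + h" using h(1) by simp
  have I_small: "I x" if "0 \<le> x" "x < h" for x using I_pos[OF that(1) less_trans[OF that(2) hh]] .
  \<comment> \<open>Finiteness of germs is now used for the class of \<open>a\<close>, a definable
    set in its own right. This is the finite index: points where the class looks alike will turn out
    to differ by an element of \<open>D\<close>.\<close>
  let ?W = "\<lambda>e y. germ_eq (X (\<lambda>v. e (Suc v))) (e 0) y"
  have W: "definable_rel M ?W" unfolding definable_rel_def germ_eq_def near_def by (intro intros definable_rel_app[OF X])
  obtain K where K: "\<And>A. finite A \<Longrightarrow> K < card A \<Longrightarrow> \<exists>b\<in>A. \<exists>c\<in>A. b \<noteq> c \<and> germ_eq (germ_eq ?Y a) b c"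
    using finite_germs[OF W, of "case_nat a s"] by auto
  have D_all: "D y" if y: "0 < y" "y < h" for y
  proof -
    \<comment> \<open>Among the multiples \<open>0, z, ..., K z\<close> two have the same germ of
      the class, so \<open>D\<close> contains \<open>d z\<close> for some positive \<open>d\<close>
      up to \<open>K\<close>. As \<open>d\<close> divides \<open>fact K\<close>, adding
      \<open>d z\<close> repeatedly reaches \<open>y\<close>.\<close>
    obtain z where z: "(\<Sum>j<(fact K :: nat). z) = y" using divisible[of "fact K" y] by auto
    have z0: "0 < z"
    proof (rule ccontr)
      assume "\<not> 0 < z"
      then have "(\<Sum>j<(fact K::nat). z) \<le> 0" by (intro sum_nonpos) simp
      with z y(1) show False by simp
    qed
    have small: "0 \<le> (\<Sum>j<i. z) \<and> (\<Sum>j<i. z) < h" if "i \<le> fact K" for i :: nat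
    proof
      show "0 \<le> (\<Sum>j<i. z)" using z0 by (intro sum_nonneg) simp
      have "(\<Sum>j<i. z) \<le> y" unfolding z[symmetric] using z0 that by (intro sum_const_mono) auto
      then show "(\<Sum>j<i. z) < h" using y(2) by simp
    qed
    let ?A = "(\<lambda>i. p + (\<Sum>j<i. z)) ` {0..K}"
    have "inj_on (\<lambda>i. p + (\<Sum>j<i. z)) {0..K}"
    proof (rule inj_onI)
      fix i k :: nat assume "p + (\<Sum>j<i. z) = p + (\<Sum>j<k. z)"
      then have "(\<Sum>j<i. z) = (\<Sum>j<k. z)" by simp
      then show "i = k" using sum_const_strict_mono[OF z0, of i k] sum_const_strict_mono[OF z0, of k i]
        by (metis less_irrefl linorder_neqE_nat)
    qed
    then have "card ?A = Suc K" by (simp add: card_image)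
    then have "\<exists>b\<in>?A. \<exists>c\<in>?A. b \<noteq> c \<and> germ_eq (germ_eq ?Y a) b c" by (intro K) auto
    then obtain i0 k0 :: nat where ik0: "i0 \<le> K" "k0 \<le> K" "(\<Sum>j<i0. z) \<noteq> (\<Sum>j<k0. z)"
      "germ_eq (germ_eq ?Y a) (p + (\<Sum>j<i0. z)) (p + (\<Sum>j<k0. z))" by auto
    have "\<exists>i k. i < k \<and> k \<le> K \<and> germ_eq (germ_eq ?Y a) (p + (\<Sum>j<i. z)) (p + (\<Sum>j<k. z))"
      using ik0 germ_eq_sym by (metis linorder_neqE_nat)
    then obtain i k where ik: "i < k" "k \<le> K" and germ: "germ_eq (germ_eq ?Y a) (p + (\<Sum>j<i. z)) (p + (\<Sum>j<k. z))"
      by blast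
    have "K \<le> fact K" by (rule fact_ge_self)
    then have kf: "k \<le> fact K" "i \<le> fact K" using ik by auto
    obtain \<delta> where \<delta>: "\<delta> > 0" "near (germ_eq ?Y a) \<delta> (p + (\<Sum>j<i. z)) (p + (\<Sum>j<k. z))"
      using germ by (auto simp: germ_eq_def[of "germ_eq ?Y a"])
    let ?m = "min \<delta> h"
    let ?zi = "\<Sum>j<i. z" and ?zk = "\<Sum>j<k. z"
    have m0: "0 < ?m" using \<delta>(1) h(1) by simp
    have bnd: "x + t < h + h" if "x < h" "t < ?m" for x t using that by (simp add: add_strict_mono)
    have "u2 \<le> p + ?zi" using p(1) small[OF kf(2)] by (simp add: add_increasing2 less_imp_le)
    moreover have "p + ?zi < p + ?zi + ?m" using m0 by simp
    moreover have "p + ?zi + ?m \<le> v2"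
    proof -
      have "?zi + ?m \<le> h + h" using small[OF kf(2)] by (intro add_mono) auto
      then have "p + (?zi + ?m) \<le> p + (h + h)" by (rule add_left_mono)
      also have "\<dots> \<le> v2" using he(2) by (rule less_imp_le)
      finally show ?thesis by (simp only: add.assoc)
    qed
    ultimately obtain c where c: "p + ?zi < c" "c < p + ?zi + ?m" "germ_eq ?Y a c" using dense by blast
    \<comment> \<open>\<open>c\<close> is a member of the dense class just to the right of
      \<open>p + ?zi\<close>. Its offset is nonzero and below \<open>\<delta>\<close>, so punctured
      agreement carries it over to \<open>p + ?zk\<close>; the difference of the two members is
      \<open>?zk - ?zi\<close>.\<close>
    define t where "t = c - p - ?zi"
    have c_eq: "c = p + (?zi + t)" "c = p + ?zi + t" by (simp_all add: t_def algebra_simps)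
    have t: "0 < t" "t < ?m" using c(1,2) unfolding c_eq(2) by simp_all
    have "D (?zi + t)" using c(3) unfolding c_eq(1) D_def .
    moreover have "D (?zk + t)"
    proof -
      have "- \<delta> < 0" using \<delta>(1) by simp
      then have "- \<delta> < t" using t(1) by (rule less_trans)
      then have "germ_eq ?Y a (p + ?zi + t) = germ_eq ?Y a (p + ?zk + t)"
        using \<delta>(2) t unfolding near_def by simp
      then show ?thesis using c(3) unfolding c_eq(2) D_def by (simp add: add.assoc)
    qed
    moreover have "I (?zi + t)" "I (?zk + t)"
      using small[OF kf(1)] small[OF kf(2)] t by (auto intro!: I_pos bnd add_nonneg_nonneg)
    ultimately have "D (?zk + t - (?zi + t))" by (intro D_diff)
    then have Dm: "D (\<Sum>j<k - i. z)" using sum_const_add[of z i "k - i"] ik by (simp add: algebra_simps)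
    have "k - i dvd fact K" using ik by (intro dvd_fact) auto
    then obtain q where q: "fact K = (k - i) * q" by (rule dvdE)
    have "D (\<Sum>j<(k - i) * r. z)" if "r \<le> q" for r
      using that
    proof (induction r)
      case 0
      then show ?case using D0 by simp
    next
      case (Suc r)
      have le: "(k - i) * r \<le> fact K" "k - i \<le> fact K"
        using Suc.prems kf unfolding q by (auto intro: le_trans)
      have "I (\<Sum>j<(k - i) * r. z)" "I (\<Sum>j<k - i. z)"
        using small[OF le(1)] small[OF le(2)] by (blast intro: I_small)+
      then have "D ((\<Sum>j<(k - i) * r. z) + (\<Sum>j<k - i. z))" using D_add Dm Suc by simp
      then show ?case by (simp add: sum_const_add[symmetric] add.commute)
    qed
    from this[OF order_refl] show ?thesis unfolding q[symmetric] z .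
  qed
  \<comment> \<open>The difference \<open>y2 - y1\<close> lies in \<open>D\<close>, so
    \<open>?Y\<close> agrees around \<open>p\<close> and around \<open>p + (y2 - y1)\<close>; this
    is evaluated at the nonzero offset \<open>y1\<close>.\<close>
  have const: "?Y (p + y1) = ?Y (p + y2)" if "0 < y1" "y1 < y2" "y2 < h" for y1 y2
  proof -
    let ?d = "y2 - y1"
    have d: "0 < ?d" "?d < h" using that by (auto simp: less_diff_eq diff_less_eq intro: less_trans add_strict_increasing)
    have "I ?d" using d by (intro I_small) auto
    from near_p[OF this D_all[OF d]] have "near ?Y \<epsilon> p (p + ?d)" .
    moreover have "I y1" using that by (intro I_small) auto
    ultimately have "?Y (p + y1) = ?Y (p + ?d + y1)" using I_eps[of y1] that(1) unfolding near_def by auto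
    then show ?thesis by (simp add: add.assoc)
  qed
  obtain y0 where y0: "0 < y0" "y0 < h" using between[OF h(1)] by blast
  have all: "?Y c = ?Y (p + y0)" if "p < c" "c < p + h" for c
  proof -
    have "0 < c - p" "c - p < h" using that by (simp_all add: diff_less_eq add.commute)
    then have "?Y (p + (c - p)) = ?Y (p + y0)" using const y0 by (metis linorder_neqE)
    then show ?thesis by simp
  qed
  have "u \<le> p" using p(1) uv2(1) 1(1) by auto
  moreover have "p < p + h" using h(1) by simp
  moreover have "p + h \<le> v"
  proof -
    have "p + h < p + (h + h)" using hh by (rule add_strict_left_mono)
    also note he(2)
    also note uv2(3)
    also note 1(3)
    finally show ?thesis by (rule less_imp_le)
  qed
  moreover have "(\<forall>y. p < y \<longrightarrow> y < p + h \<longrightarrow> ?Y y) \<or> (\<forall>y. p < y \<longrightarrow> y < p + h \<longrightarrow> \<not> ?Y y)"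
    using all by (cases "?Y (p + y0)") auto
  ultimately show ?thesis by blast
qed

text \<open>By the dichotomy the last piece either fills a subinterval or is absent from one, which
  the remaining pieces then cover.\<close>

lemma interval_partition:
  assumes Q: "\<And>i. i < (r::nat) \<Longrightarrow> definable_rel M (Q i)" and "u < v"
    and "\<forall>y. u < y \<longrightarrow> y < v \<longrightarrow> (\<exists>i<r. Q i s y)"
  shows "\<exists>i<r. \<exists>u' v'. u \<le> u' \<and> u' < v' \<and> v' \<le> v \<and> (\<forall>y. u' < y \<longrightarrow> y < v' \<longrightarrow> Q i s y)"
  using assms
proof (induction r arbitrary: u v)
  case 0
  then show ?case using between by blast
next
  case (Suc r)
  have Qr: "definable_rel M (Q r)" using Suc.prems(1) by simp
  obtain u1 v1 where 1: "u \<le> u1" "u1 < v1" "v1 \<le> v"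
    and or: "(\<forall>y. u1 < y \<longrightarrow> y < v1 \<longrightarrow> Q r s y) \<or> (\<forall>y. u1 < y \<longrightarrow> y < v1 \<longrightarrow> \<not> Q r s y)"
    using interval_dichotomy[OF Qr Suc.prems(2), of s] by blast
  from or show ?case
  proof
    assume "\<forall>y. u1 < y \<longrightarrow> y < v1 \<longrightarrow> Q r s y"
    with 1 show ?thesis by blast
  next
    assume not: "\<forall>y. u1 < y \<longrightarrow> y < v1 \<longrightarrow> \<not> Q r s y"
    have "\<exists>i<r. Q i s y" if "u1 < y" "y < v1" for y
    proof -
      have "u < y" "y < v" using that 1 by auto
      then obtain i where "i < Suc r" "Q i s y" using Suc.prems(3) by blast
      then show ?thesis using not that by (metis less_SucE)
    qed
    then have "\<forall>y. u1 < y \<longrightarrow> y < v1 \<longrightarrow> (\<exists>i<r. Q i s y)" by blast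
    from Suc.IH[OF Suc.prems(1) 1(2) this] obtain i u' v' where 2: "i < r" "u1 \<le> u'" "u' < v'" "v' \<le> v1" "\<forall>y. u' < y \<longrightarrow> y < v' \<longrightarrow> Q i s y"
      by auto
    then have "i < Suc r" "u \<le> u'" "v' \<le> v" using 1 by auto
    with 2 show ?thesis by blast
  qed
qed

end

section \<open>Partitions of boxes\<close>

context dp_minimal_group
begin

text \<open>If no piece is locally constant along a fibre on a whole box, then for any finite set of
  heights some fibre has all of them as boundary points. As boundary sets are nowhere dense, this
  produces the pattern \<open>y \<in> Bd x' - Bd x\<close> for consecutive points \<open>x\<close>, \<open>x'\<close> of a sequence.\<close>
lemma partition_prop_Suc:
  assumes A: "partition_prop n" and B: "bound_prop n"
  shows "partition_prop (Suc n)"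
  unfolding partition_prop_def
proof (intro allI impI)
  fix r :: nat and P and lo hi s :: "nat \<Rightarrow> 'a"
  assume P: "\<forall>i<r. definable_pred M (P i)" and proper: "\<forall>i<Suc n. lo i < hi i"
    and cover: "\<forall>x\<in>box (Suc n) lo hi s. \<exists>i<r. P i x"
  \<comment> \<open>The margin of \<open>x\<close> inside the piece \<open>i\<close> along the last
    coordinate, written so that the inductive lower bound applies to it.\<close>
  let ?F = "\<lambda>i x \<epsilon>. \<forall>y. x n - \<epsilon> < y \<longrightarrow> y < x n + \<epsilon> \<longrightarrow> P i (x(n := y))"
  define In where "In i x \<longleftrightarrow> (\<exists>\<epsilon>>0. ?F i x \<epsilon>)" for i x
  define Bd where "Bd x \<longleftrightarrow> (\<forall>i<r. \<not> In i x)" for x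
  have F: "definable_rel M (?F i)" if "i < r" for i
  proof -
    have Pi: "definable_pred M (P i)" using P that by blast
    show ?thesis unfolding definable_rel_def by (intro intros definable_pred_subst[OF Pi])
  qed
  have In: "definable_pred M (In i)" if "i < r" for i
    unfolding In_def
  proof (rule definable_pred_Ex, rule definable_pred_conj)
    show "definable_pred M (\<lambda>s. 0 < s 0)" by (intro intros)
    show "definable_pred M (\<lambda>s. ?F i (\<lambda>v. s (Suc v)) (s 0))" using F[OF that] unfolding definable_rel_def .
  qed
  have Bd: "definable_pred M Bd" unfolding Bd_def by (intro definable_pred_all_less definable_pred_Not In)
  have properN: "subbox n lo hi lo hi" using proper by (intro subbox_refl) simp
  show "\<exists>i<r. \<exists>lo' hi'. subbox (Suc n) lo hi lo' hi' \<and> (\<forall>x\<in>box (Suc n) lo' hi' s. P i x)"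
  \<comment> \<open>In the first case the inductive bound makes the margin uniform, and the box at
    height \<open>c\<close> thickens to a box of dimension \<open>n + 1\<close>. The other case
    leads to a pattern.\<close>
  proof (cases "\<exists>c lo' hi' i. lo n < c \<and> c < hi n \<and> subbox n lo hi lo' hi' \<and> i < r \<and> (\<forall>x\<in>box n lo' hi' s. In i (x(n := c)))")
    case True
    then obtain c lo1 hi1 i where c: "lo n < c" "c < hi n" and sub: "subbox n lo hi lo1 hi1" and i: "i < r"
      and inside: "\<forall>x\<in>box n lo1 hi1 s. In i (x(n := c))" by blast
    have "\<forall>x\<in>box n lo1 hi1 (s(n := c)).
      (\<exists>\<epsilon>>0. ?F i x \<epsilon>) \<and> (\<forall>\<epsilon> \<delta>. ?F i x \<epsilon> \<longrightarrow> 0 < \<delta> \<longrightarrow> \<delta> \<le> \<epsilon> \<longrightarrow> ?F i x \<delta>)"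
    proof (intro ballI conjI)
      fix x assume "x \<in> box n lo1 hi1 (s(n := c))"
      then show "\<exists>\<epsilon>>0. ?F i x \<epsilon>"
        using inside[folded box_update_param[of n lo1 hi1 s c "In i"]] unfolding In_def by blast
      show "\<forall>\<epsilon> \<delta>. ?F i x \<epsilon> \<longrightarrow> 0 < \<delta> \<longrightarrow> \<delta> \<le> \<epsilon> \<longrightarrow> ?F i x \<delta>"
      proof (intro allI impI)
        fix \<epsilon> \<delta> y assume *: "?F i x \<epsilon>" "\<delta> \<le> \<epsilon>" "x n - \<delta> < y" "y < x n + \<delta>"
        have "x n - \<epsilon> \<le> x n - \<delta>" "x n + \<delta> \<le> x n + \<epsilon>" using *(2) by simp_all
        then have "x n - \<epsilon> < y" "y < x n + \<epsilon>" using *(3,4) by (blast intro: order_le_less_trans order_less_le_trans)+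
        then show "P i (x(n := y))" using *(1) by blast
      qed
    qed
    from bound_propD[OF B F[OF i] subbox_proper[OF sub] this] obtain lo2 hi2 \<epsilon> where
      2: "subbox n lo1 hi1 lo2 hi2" "0 < \<epsilon>" and "\<forall>x\<in>box n lo2 hi2 (s(n := c)). ?F i x \<epsilon>" by blast
    then have Fx: "\<forall>x\<in>box n lo2 hi2 s. ?F i (x(n := c)) \<epsilon>" unfolding box_update_param[of n lo2 hi2 s c "\<lambda>x. ?F i x \<epsilon>"] by blast
    let ?lo = "lo2(n := max (lo n) (c - \<epsilon>))" and ?hi = "hi2(n := min (hi n) (c + \<epsilon>))"
    have "max (lo n) (c - \<epsilon>) < c" "c < min (hi n) (c + \<epsilon>)" using c 2(2) by simp_all
    then have "max (lo n) (c - \<epsilon>) < min (hi n) (c + \<epsilon>)" by (rule less_trans)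
    moreover have "subbox n lo hi lo2 hi2" by (rule subbox_trans[OF sub 2(1)])
    ultimately have "subbox (Suc n) lo hi ?lo ?hi" unfolding subbox_def by (simp add: less_Suc_eq)
    moreover have "\<forall>x\<in>box (Suc n) ?lo ?hi s. P i x"
      unfolding box_Suc_iff
    proof (intro allI impI ballI)
      fix y x assume y: "?lo n < y \<and> y < ?hi n" and "x \<in> box n ?lo ?hi s"
      then have "x \<in> box n lo2 hi2 s" by (simp add: box_def)
      then have "P i ((x(n := c))(n := y))" using Fx y by simp
      then show "P i (x(n := y))" by simp
    qed
    ultimately show ?thesis using i by blast
  next
    case False
    have bd1: "\<exists>lo2 hi2. subbox n lo1 hi1 lo2 hi2 \<and> (\<forall>x\<in>box n lo2 hi2 s. Bd (x(n := c)))"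
      if sub: "subbox n lo hi lo1 hi1" and c: "lo n < c" "c < hi n" for lo1 hi1 c
    proof -
      \<comment> \<open>\<open>Bd\<close> is added as a last piece with index \<open>r\<close>. The
        inductive partition must return it, since the other outcomes are excluded in this
        case.\<close>
      let ?Q = "\<lambda>i. if i < r then In i else Bd"
      have "definable_pred M (?Q i)" if "i < Suc r" for i using In Bd by simp
      moreover have "\<forall>x\<in>box n lo1 hi1 (s(n := c)). \<exists>i<Suc r. ?Q i x"
      proof
        fix x show "\<exists>i<Suc r. ?Q i x"
        proof (cases "Bd x")
          case True
          then show ?thesis by (intro exI[of _ r]) simp
        next
          case False
          then obtain i where "i < r" "In i x" unfolding Bd_def by blast
          then show ?thesis by (intro exI[of _ i]) simp
        qed
      qed
      ultimately have "\<exists>i<Suc r. \<exists>lo' hi'. subbox n lo1 hi1 lo' hi' \<and> (\<forall>x\<in>box n lo' hi' (s(n := c)). ?Q i x)"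
        using partition_propD[OF A _ subbox_proper[OF sub], of "Suc r" ?Q] by blast
      then obtain i lo2 hi2 where 2: "i < Suc r" "subbox n lo1 hi1 lo2 hi2" "\<forall>x\<in>box n lo2 hi2 (s(n := c)). ?Q i x"
        by blast
      from 2(3) have Q: "\<forall>x\<in>box n lo2 hi2 s. ?Q i (x(n := c))"
        by (rule iffD1[OF box_update_param[of n lo2 hi2 s c "?Q i"]])
      have "\<not> i < r"
      proof
        assume "i < r"
        then have "\<forall>x\<in>box n lo2 hi2 s. In i (x(n := c))" using Q by simp
        then show False using False c subbox_trans[OF sub 2(2)] \<open>i < r\<close> by blast
      qed
      with Q 2(2) show ?thesis by auto
    qed
    have bd: "\<exists>lo1 hi1. subbox n lo hi lo1 hi1 \<and> (\<forall>x\<in>box n lo1 hi1 s. \<forall>c\<in>C. Bd (x(n := c)))"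
      if "finite C" "C \<subseteq> {lo n<..<hi n}" for C
      using that
    proof (induction C rule: finite_induct)
      case empty
      then show ?case using properN by blast
    next
      case (insert c C)
      from insert.prems have "C \<subseteq> {lo n<..<hi n}" by blast
      from insert.IH[OF this] obtain lo1 hi1 where
        1: "subbox n lo hi lo1 hi1" "\<forall>x\<in>box n lo1 hi1 s. \<forall>c\<in>C. Bd (x(n := c))" by blast
      have "lo n < c" "c < hi n" using insert.prems by auto
      from bd1[OF 1(1) this] obtain lo2 hi2 where 2: "subbox n lo1 hi1 lo2 hi2" "\<forall>x\<in>box n lo2 hi2 s. Bd (x(n := c))" by blast
      have "\<forall>x\<in>box n lo2 hi2 s. \<forall>c\<in>insert c C. Bd (x(n := c))" using 1(2) 2(2) box_mono[OF 2(1)] by blast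
      then show ?case using subbox_trans[OF 1(1) 2(1)] by blast
    qed
    have bd_point: "\<exists>x\<in>box n lo hi s. \<forall>c\<in>C. Bd (x(n := c))" if C: "finite C" "C \<subseteq> {lo n<..<hi n}" for C
    proof -
      obtain lo1 hi1 where 1: "subbox n lo hi lo1 hi1" "\<forall>x\<in>box n lo1 hi1 s. \<forall>c\<in>C. Bd (x(n := c))" using bd[OF C] by blast
      obtain x where "x \<in> box n lo1 hi1 s" using box_nonempty[OF subbox_proper[OF 1(1)]] by blast
      then show ?thesis using 1(2) box_mono[OF 1(1)] by blast
    qed
    \<comment> \<open>Over one base point the boundary is nowhere dense: by the result for
      intervals, some subinterval lies in one piece and so has no boundary points. Finitely many
      base points are treated in turn.\<close>
    have avoid: "\<exists>u' v'. u \<le> u' \<and> u' < v' \<and> v' \<le> v \<and> (\<forall>x\<in>Z. \<forall>y. u' < y \<longrightarrow> y < v' \<longrightarrow> \<not> Bd (x(n := y)))"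
      if "finite Z" "Z \<subseteq> box n lo hi s" "lo n \<le> u" "u < v" "v \<le> hi n" for Z u v
      using that
    proof (induction Z rule: finite_induct)
      case empty
      then show ?case by blast
    next
      case (insert x Z)
      from insert.prems have "Z \<subseteq> box n lo hi s" by blast
      from insert.IH[OF this insert.prems(2-4)] obtain u1 v1 where
        1: "u \<le> u1" "u1 < v1" "v1 \<le> v" "\<forall>x\<in>Z. \<forall>y. u1 < y \<longrightarrow> y < v1 \<longrightarrow> \<not> Bd (x(n := y))" by blast
      have Q: "definable_rel M (\<lambda>x y. P i (x(n := y)))" if "i < r" for i
      proof -
        have Pi: "definable_pred M (P i)" using P that by blast
        show ?thesis unfolding definable_rel_def by (intro intros definable_pred_subst[OF Pi])
      qed
      have "\<forall>y. u1 < y \<longrightarrow> y < v1 \<longrightarrow> (\<exists>i<r. P i (x(n := y)))"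
      proof (intro allI impI)
        fix y assume "u1 < y" "y < v1"
        then have "lo n < y" "y < hi n" using 1 insert.prems by auto
        then show "\<exists>i<r. P i (x(n := y))" using cover[unfolded box_Suc_iff] insert.prems by blast
      qed
      from interval_partition[OF Q 1(2) this] obtain i u2 v2 where 2: "i < r" "u1 \<le> u2" "u2 < v2" "v2 \<le> v1"
        "\<forall>y. u2 < y \<longrightarrow> y < v2 \<longrightarrow> P i (x(n := y))" by blast
      have "\<not> Bd (x(n := y))" if y: "u2 < y" "y < v2" for y
      proof -
        let ?\<epsilon> = "min (y - u2) (v2 - y)"
        have "P i ((x(n := y))(n := z))" if z: "(x(n := y)) n - ?\<epsilon> < z" "z < (x(n := y)) n + ?\<epsilon>" for z
        proof -
          have "?\<epsilon> \<le> y - u2" "?\<epsilon> \<le> v2 - y" by (rule min.cobounded1, rule min.cobounded2)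
          then have "u2 \<le> y - ?\<epsilon>" "y + ?\<epsilon> \<le> v2" by (simp_all only: le_diff_eq add.commute)
          then show ?thesis using z 2(5) by auto
        qed
        moreover have "0 < ?\<epsilon>" using y by simp
        ultimately have "In i (x(n := y))" unfolding In_def by blast
        then show ?thesis unfolding Bd_def using 2(1) by blast
      qed
      then have "\<forall>x\<in>insert x Z. \<forall>y. u2 < y \<longrightarrow> y < v2 \<longrightarrow> \<not> Bd (x(n := y))"
        using 1(4) order_le_less_trans[OF 2(2)] order_less_le_trans[OF _ 2(4)] by blast
      moreover have "u \<le> u2" "v2 \<le> v" using 1 2 by auto
      ultimately show ?case using 2(3) by blast
    qed
    \<comment> \<open>Even and odd entries of \<open>e\<close> hold two base points, so one
      parameter sequence encodes a pair of fibres.\<close>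
    let ?\<Psi> = "\<lambda>e y. Bd ((\<lambda>v. e (Suc (2 * v)))(n := y)) \<and> \<not> Bd ((\<lambda>v. e (2 * v))(n := y))"
    have "definable_rel M ?\<Psi>" unfolding definable_rel_def by (intro intros definable_pred_subst[OF Bd])
    moreover have "lo n < hi n" using proper by simp
    ultimately have "\<exists>(k::nat) L R. (\<forall>i<k. lo n \<le> L i \<and> L i < R i \<and> R i \<le> hi n) \<and>
        \<not> (\<exists>b x. \<forall>i<k. \<forall>j<k. L i < x i j \<and> x i j < R i \<and> (\<forall>l<k. ?\<Psi> (b l) (x i j) \<longleftrightarrow> l = j))"
      by (rule no_interval_pattern)
    then obtain k :: nat and L R where LR_no: "(\<forall>i<k. lo n \<le> L i \<and> L i < R i \<and> R i \<le> hi n) \<and>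
        \<not> (\<exists>b x. \<forall>i<k. \<forall>j<k. L i < x i j \<and> x i j < R i \<and> (\<forall>l<k. ?\<Psi> (b l) (x i j) \<longleftrightarrow> l = j))"
      by (elim exE)
    note LR = LR_no[THEN conjunct1] and no = LR_no[THEN conjunct2]
    \<comment> \<open>A staircase: the heights of round \<open>j\<close> are boundary points exactly
      over the base points chosen after that round. Hence \<open>x l\<close> and
      \<open>x (Suc l)\<close> disagree on round \<open>l\<close> and on no other.\<close>
    have iter: "\<exists>x c. (\<forall>l\<le>m. x l \<in> box n lo hi s) \<and>
        (\<forall>j<m. \<forall>i<k. L i < c j i \<and> c j i < R i \<and> (\<forall>l\<le>m. Bd ((x l)(n := c j i)) \<longleftrightarrow> j < l))" for m :: nat
    proof (induction m)
      case 0
      obtain x where "x \<in> box n lo hi s" using box_nonempty[OF subbox_proper[OF properN]] by blast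
      then show ?case by (intro exI[of _ "\<lambda>_. x"]) simp
    next
      case (Suc m)
      then obtain x c where IH: "(\<forall>l\<le>m. x l \<in> box n lo hi s) \<and>
        (\<forall>j<m. \<forall>i<k. L i < c j i \<and> c j i < R i \<and> (\<forall>l\<le>m. Bd ((x l)(n := c j i)) \<longleftrightarrow> j < l))" by (elim exE)
      \<comment> \<open>The new heights avoid the boundaries over all earlier base points; the next
        base point is then chosen to have every height so far as a boundary point.\<close>
      have "\<forall>i. \<exists>d. i < k \<longrightarrow> L i < d \<and> d < R i \<and> (\<forall>l\<le>m. \<not> Bd ((x l)(n := d)))"
      proof
        fix i
        show "\<exists>d. i < k \<longrightarrow> L i < d \<and> d < R i \<and> (\<forall>l\<le>m. \<not> Bd ((x l)(n := d)))"
        proof (cases "i < k")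
          case True
          then have "lo n \<le> L i" "L i < R i" "R i \<le> hi n" using LR by auto
          moreover have "x ` {..m} \<subseteq> box n lo hi s" using IH by auto
          ultimately obtain u' v' where uv': "L i \<le> u'" "u' < v'" "v' \<le> R i"
            "\<forall>x\<in>x ` {..m}. \<forall>y. u' < y \<longrightarrow> y < v' \<longrightarrow> \<not> Bd (x(n := y))"
            using avoid[of "x ` {..m}" "L i" "R i"] by auto
          obtain d where d: "u' < d" "d < v'" using between[OF uv'(2)] by blast
          have "L i < d" "d < R i" using uv' d by auto
          then show ?thesis using uv'(4) d by auto
        qed simp
      qed
      from choice[OF this] obtain d where d: "\<forall>i. i < k \<longrightarrow> L i < d i \<and> d i < R i \<and> (\<forall>l\<le>m. \<not> Bd ((x l)(n := d i)))" ..
      let ?c = "c(m := d)"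
      let ?C = "(\<lambda>(j, i). ?c j i) ` ({..m} \<times> {..<k})"
      have c_bounds: "L i < ?c j i \<and> ?c j i < R i" if "j \<le> m" "i < k" for j i
        using IH d that by (cases "j = m") auto
      have "?C \<subseteq> {lo n<..<hi n}"
      proof
        fix y assume "y \<in> ?C"
        then obtain i j where ji: "y = ?c j i" "j \<le> m" "i < k" by auto
        have "lo n \<le> L i" "R i \<le> hi n" using LR ji(3) by auto
        then show "y \<in> {lo n<..<hi n}" using c_bounds[OF ji(2,3)] unfolding ji(1) greaterThanLessThan_iff
          by (blast intro: order_le_less_trans order_less_le_trans)
      qed
      moreover have "finite ?C" by simp
      ultimately obtain x' where x': "x' \<in> box n lo hi s" "\<forall>y\<in>?C. Bd (x'(n := y))" using bd_point by blast
      let ?x = "x(Suc m := x')"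
      have 1: "\<forall>l\<le>Suc m. ?x l \<in> box n lo hi s" using IH x'(1) by (simp add: le_Suc_eq)
      have 2: "\<forall>j<Suc m. \<forall>i<k. L i < ?c j i \<and> ?c j i < R i \<and> (\<forall>l\<le>Suc m. Bd ((?x l)(n := ?c j i)) \<longleftrightarrow> j < l)"
      proof (intro allI impI, goal_cases)
        case ji: (1 j i)
        have "Bd ((?x l)(n := ?c j i)) \<longleftrightarrow> j < l" if l: "l \<le> Suc m" for l
        proof (cases "l = Suc m")
          case True
          have "?c j i \<in> ?C" using ji by (intro image_eqI[of _ _ "(j, i)"]) auto
          then have "Bd (x'(n := ?c j i))" using x'(2) by blast
          then show ?thesis using True ji by simp
        next
          case False
          then have "l \<le> m" using l by simp
          then show ?thesis using False d IH ji by (cases "j = m") auto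
        qed
        then show ?case using c_bounds ji by simp
      qed
      show ?case by (rule exI[of _ ?x], rule exI[of _ ?c]) (intro conjI 1 2)
    qed
    \<comment> \<open>The \<open>k\<close> consecutive pairs require the \<open>k + 1\<close> base
      points \<open>x 0\<close> up to \<open>x k\<close>, which is why the invariant includes
      \<open>l = m\<close>.\<close>
    from iter[of k] obtain x c where xc: "(\<forall>l\<le>k. x l \<in> box n lo hi s) \<and>
        (\<forall>j<k. \<forall>i<k. L i < c j i \<and> c j i < R i \<and> (\<forall>l\<le>k. Bd ((x l)(n := c j i)) \<longleftrightarrow> j < l))" by (elim exE)
    let ?b = "\<lambda>l v. if even v then x l (v div 2) else x (Suc l) (v div 2)"
    have \<Psi>: "?\<Psi> (?b l) (c j i) \<longleftrightarrow> l = j" if ijl: "i < k" "j < k" "l < k" for i j l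
    proof -
      have "Bd ((x l)(n := c j i)) \<longleftrightarrow> j < l" "Bd ((x (Suc l))(n := c j i)) \<longleftrightarrow> j < Suc l"
        using xc ijl by auto
      then show ?thesis by auto
    qed
    have LRc: "L i < c j i \<and> c j i < R i" if "i < k" "j < k" for i j using xc that by blast
    have False
      by (rule notE[OF no], rule exI[of _ ?b], rule exI[of _ "\<lambda>i j. c j i"])
        (intro allI impI conjI, erule (1) LRc[THEN conjunct1], erule (1) LRc[THEN conjunct2], rule \<Psi>, assumption+)
    then show ?thesis ..
  qed
qed

lemma partition_and_bound: "partition_prop n \<and> bound_prop n"
proof (induction n)
  case 0
  show ?case using partition_prop_0 bound_prop_0 by blast
next
  case (Suc n)
  then have "partition_prop (Suc n)" using partition_prop_Suc by blast
  then show ?case using bound_prop_Suc Suc by blast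
qed

end

section \<open>From assignments back to lists of coordinates\<close>

lemma open_box_of_box:
  assumes "\<forall>i<n. lo i < hi i"
  shows "open_box n {xs. length xs = n \<and> (\<forall>i<n. lo i < xs ! i \<and> xs ! i < hi i)}"
  unfolding open_box_def
  by (rule exI[of _ "map lo [0..<n]"], rule exI[of _ "map hi [0..<n]"]) (use assms in auto)

context dp_minimal_group
begin

lemma definable_partition_interior:
  assumes X: "nonempty_interior n X" and Xs: "\<forall>i<(r :: nat). definable M n (Xs i)" and cover: "X \<subseteq> (\<Union>i<r. Xs i)"
  shows "\<exists>i<r. nonempty_interior n (Xs i)"
proof -
  have "\<forall>i :: nat. \<exists>\<phi> \<sigma>. i < r \<longrightarrow> Xs i = {xs. length xs = n \<and> sat M (\<lambda>v. if v < n then xs ! v else \<sigma> v) \<phi>}"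
    using Xs unfolding definable_def by blast
  from choice[OF this] obtain \<phi> where
    "\<forall>i. \<exists>\<sigma>. i < r \<longrightarrow> Xs i = {xs. length xs = n \<and> sat M (\<lambda>v. if v < n then xs ! v else \<sigma> v) (\<phi> i)}" ..
  from choice[OF this] obtain \<sigma> where
    q: "\<And>i. i < r \<Longrightarrow> Xs i = {xs. length xs = n \<and> sat M (\<lambda>v. if v < n then xs ! v else \<sigma> i v) (\<phi> i)}" by blast
  \<comment> \<open>Each piece comes with its own parameters, but a box has only one parameter
    assignment. The pairing function stores all the \<open>\<sigma> i\<close> in it from index
    \<open>n\<close> on, and \<open>?\<rho> i\<close> reads off those of piece
    \<open>i\<close>.\<close>
  let ?s = "\<lambda>v. \<sigma> (fst (prod_decode (v - n))) (snd (prod_decode (v - n)))"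
  let ?\<rho> = "\<lambda>i v. if v < n then v else n + prod_encode (i, v)"
  let ?P = "\<lambda>i x. sat M (\<lambda>v. x (?\<rho> i v)) (\<phi> i)"
  have eq: "(\<lambda>v. x (?\<rho> i v)) = (\<lambda>v. if v < n then xs ! v else \<sigma> i v)"
    if "\<forall>v<n. x v = xs ! v" "\<forall>v\<ge>n. x v = ?s v" for x i and xs :: "'a list"
    using that by auto
  obtain lo hi where lh: "\<forall>i<n. lo ! i < hi ! i"
    and sub: "{xs. length xs = n \<and> (\<forall>i<n. lo ! i < xs ! i \<and> xs ! i < hi ! i)} \<subseteq> X"
    using X by (auto simp: nonempty_interior_def open_box_def)
  have "\<forall>x\<in>box n (\<lambda>i. lo ! i) (\<lambda>i. hi ! i) ?s. \<exists>i<r. ?P i x"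
  proof
    fix x assume x: "x \<in> box n (\<lambda>i. lo ! i) (\<lambda>i. hi ! i) ?s"
    let ?xs = "map x [0..<n]"
    have "?xs \<in> X" using x sub by (auto simp: box_def)
    then obtain i where i: "i < r" "?xs \<in> Xs i" using cover by blast
    have "(\<lambda>v. x (?\<rho> i v)) = (\<lambda>v. if v < n then ?xs ! v else \<sigma> i v)"
      by (rule eq) (use x in \<open>simp_all add: box_def\<close>)
    then have "?P i x" using i(2) unfolding q[OF i(1)] by simp
    then show "\<exists>i<r. ?P i x" using i(1) by blast
  qed
  moreover have "definable_pred M (?P i)" for i
    by (rule definable_pred_rename[of M "\<lambda>x. sat M x (\<phi> i)"]) (auto simp: definable_pred_def)
  ultimately have "\<exists>i<r. \<exists>lo' hi'. subbox n (\<lambda>i. lo ! i) (\<lambda>i. hi ! i) lo' hi' \<and> (\<forall>x\<in>box n lo' hi' ?s. ?P i x)"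
    using partition_propD[OF partition_and_bound[THEN conjunct1] _ lh, of r ?P ?s] by blast
  then obtain i lo' hi' where i: "i < r" "subbox n (\<lambda>i. lo ! i) (\<lambda>i. hi ! i) lo' hi'" "\<forall>x\<in>box n lo' hi' ?s. ?P i x"
    by blast
  let ?B = "{xs. length xs = n \<and> (\<forall>i<n. lo' i < xs ! i \<and> xs ! i < hi' i)}"
  have "?B \<subseteq> Xs i"
  proof
    fix xs assume xs: "xs \<in> ?B"
    let ?x = "\<lambda>v. if v < n then xs ! v else ?s v"
    have x: "?x \<in> box n lo' hi' ?s" using xs by (simp add: box_def)
    have "?P i ?x" by (rule bspec[OF i(3) x])
    moreover have "(\<lambda>v. ?x (?\<rho> i v)) = (\<lambda>v. if v < n then xs ! v else \<sigma> i v)"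
      by (rule eq) simp_all
    ultimately have "sat M (\<lambda>v. if v < n then xs ! v else \<sigma> i v) (\<phi> i)" by simp
    then show "xs \<in> Xs i" using xs unfolding q[OF i(1)] by simp
  qed
  then show ?thesis using i(1) open_box_of_box[OF subbox_proper[OF i(2)]] unfolding nonempty_interior_def by blast
qed

lemma definable_fun_bounded_below:
  assumes f: "definable_fun M n f" and pos: "\<forall>x. length x = n \<longrightarrow> pos_cut (f x)" and B: "open_box n B"
  shows "\<exists>B' \<epsilon>. open_box n B' \<and> B' \<subseteq> B \<and> \<epsilon> > 0 \<and> (\<forall>x\<in>B'. \<epsilon> \<in> f x)"
proof -
  obtain \<phi> s where graph: "{xs @ [c] | xs c. length xs = n \<and> c \<in> f xs} =
      {xs. length xs = Suc n \<and> sat M (\<lambda>v. if v < Suc n then xs ! v else s v) \<phi>}"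
    using f by (auto simp: definable_fun_def definable_def)
  have f_iff: "c \<in> f xs \<longleftrightarrow> sat M (\<lambda>v. if v < Suc n then (xs @ [c]) ! v else s v) \<phi>" if "length xs = n" for xs c
  proof -
    have "c \<in> f xs \<longleftrightarrow> xs @ [c] \<in> {xs @ [c] | xs c. length xs = n \<and> c \<in> f xs}" using that by auto
    also have "\<dots> \<longleftrightarrow> sat M (\<lambda>v. if v < Suc n then (xs @ [c]) ! v else s v) \<phi>"
      unfolding graph using that by simp
    finally show ?thesis .
  qed
  \<comment> \<open>The graph has the value as its last coordinate, that is, in variable
    \<open>n\<close>; the entry of \<open>s\<close> stored there is overwritten by
    \<open>\<epsilon>\<close>.\<close>
  let ?F = "\<lambda>x \<epsilon>. sat M (x(n := \<epsilon>)) \<phi>"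
  have F: "?F x \<epsilon> \<longleftrightarrow> \<epsilon> \<in> f xs" if "length xs = n" "\<forall>v<n. x v = xs ! v" "\<forall>v\<ge>n. x v = s v" for x \<epsilon> xs
  proof -
    have "x(n := \<epsilon>) = (\<lambda>v. if v < Suc n then (xs @ [\<epsilon>]) ! v else s v)"
      using that by (auto simp: fun_eq_iff nth_append less_Suc_eq)
    then show ?thesis using f_iff[OF that(1)] by simp
  qed
  have \<phi>: "definable_pred M (\<lambda>x. sat M x \<phi>)" by (auto simp: definable_pred_def)
  have dF: "definable_rel M ?F" unfolding definable_rel_def by (intro intros definable_pred_subst[OF \<phi>])
  obtain lo hi where lh: "\<forall>i<n. lo ! i < hi ! i"
    and B_eq: "B = {xs. length xs = n \<and> (\<forall>i<n. lo ! i < xs ! i \<and> xs ! i < hi ! i)}"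
    using B by (auto simp: open_box_def)
  have "\<forall>x\<in>box n (\<lambda>i. lo ! i) (\<lambda>i. hi ! i) s. (\<exists>\<epsilon>>0. ?F x \<epsilon>) \<and> (\<forall>\<epsilon> \<delta>. ?F x \<epsilon> \<longrightarrow> 0 < \<delta> \<longrightarrow> \<delta> \<le> \<epsilon> \<longrightarrow> ?F x \<delta>)"
  proof
    fix x assume x: "x \<in> box n (\<lambda>i. lo ! i) (\<lambda>i. hi ! i) s"
    let ?xs = "map x [0..<n]"
    have Fx: "?F x \<epsilon> \<longleftrightarrow> \<epsilon> \<in> f ?xs" for \<epsilon> by (rule F) (use x in \<open>simp_all add: box_def\<close>)
    have "pos_cut (f ?xs)" using pos by simp
    then have cut: "\<forall>c\<in>f ?xs. \<forall>d. d \<le> c \<longrightarrow> d \<in> f ?xs" "\<exists>d\<in>f ?xs. 0 < d" unfolding pos_cut_def by blast+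
    show "(\<exists>\<epsilon>>0. ?F x \<epsilon>) \<and> (\<forall>\<epsilon> \<delta>. ?F x \<epsilon> \<longrightarrow> 0 < \<delta> \<longrightarrow> \<delta> \<le> \<epsilon> \<longrightarrow> ?F x \<delta>)"
      unfolding Fx using cut by blast
  qed
  from bound_propD[OF partition_and_bound[THEN conjunct2] dF lh this] obtain lo' hi' \<epsilon> where
    1: "subbox n (\<lambda>i. lo ! i) (\<lambda>i. hi ! i) lo' hi'" "0 < \<epsilon>" "\<forall>x\<in>box n lo' hi' s. ?F x \<epsilon>" by blast
  let ?B = "{xs. length xs = n \<and> (\<forall>i<n. lo' i < xs ! i \<and> xs ! i < hi' i)}"
  have "\<epsilon> \<in> f xs \<and> xs \<in> B" if xs: "xs \<in> ?B" for xs
  proof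
    let ?x = "\<lambda>v. if v < n then xs ! v else s v"
    have x: "?x \<in> box n lo' hi' s" using xs by (simp add: box_def)
    have "?F ?x \<epsilon> \<longleftrightarrow> \<epsilon> \<in> f xs" by (rule F) (use xs in simp_all)
    then show "\<epsilon> \<in> f xs" using bspec[OF 1(3) x] by (rule iffD1)
    have "?x \<in> box n (\<lambda>i. lo ! i) (\<lambda>i. hi ! i) s" by (rule box_mono[OF 1(1) x])
    then show "xs \<in> B" using xs unfolding B_eq by (simp add: box_def)
  qed
  then show ?thesis using open_box_of_box[OF subbox_proper[OF 1(1)]] 1(2) by blast
qed

end

theorem theorem3p4:
  fixes M :: "('a::linordered_ab_group_add, 'f, 'r) struct" and pl :: 'f and ls :: 'r
  assumes plus: "\<forall>x y. fst M pl [x, y] = x + y"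
    and less: "\<forall>x y. snd M ls [x, y] \<longleftrightarrow> x < y"
    and divisible: "\<forall>x. \<forall>n::nat. n > 0 \<longrightarrow> (\<exists>y::'a. (\<Sum>i<n. y) = x)"
    and nontrivial: "\<exists>x::'a. x \<noteq> 0"
    and dpmin: "dp_minimal M"
  shows "\<forall>n::nat. n \<ge> 1 \<longrightarrow>
     (\<forall>X (Xs :: nat \<Rightarrow> 'a list set) r.
        definable M n X \<and> nonempty_interior n X \<and> (\<forall>i<r. definable M n (Xs i)) \<and>
        X = (\<Union>i<r. Xs i) \<and> (\<forall>i<r. \<forall>j<r. i \<noteq> j \<longrightarrow> Xs i \<inter> Xs j = {})
        \<longrightarrow> (\<exists>i<r. nonempty_interior n (Xs i))) \<and>
     (\<forall>f :: 'a list \<Rightarrow> 'a set.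
        definable_fun M n f \<and> (\<forall>x. length x = n \<longrightarrow> pos_cut (f x))
        \<longrightarrow> (\<forall>B. open_box n B \<longrightarrow>
              (\<exists>B' \<epsilon>. open_box n B' \<and> B' \<subseteq> B \<and> \<epsilon> > 0 \<and> (\<forall>x\<in>B'. \<epsilon> \<in> f x))))"
proof -
  interpret dp_minimal_group M pl ls
    by unfold_locales (use assms in auto)
  show ?thesis
  proof (intro allI impI conjI; elim conjE)
    fix n :: nat and X :: "'a list set" and Xs :: "nat \<Rightarrow> 'a list set" and r :: nat
    assume "nonempty_interior n X" "\<forall>i<r. definable M n (Xs i)" "X = (\<Union>i<r. Xs i)"
    then show "\<exists>i<r. nonempty_interior n (Xs i)" by (intro definable_partition_interior[of n X]) auto
  next
    fix n :: nat and f :: "'a list \<Rightarrow> 'a set" and B :: "'a list set"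
    assume "definable_fun M n f" "\<forall>x. length x = n \<longrightarrow> pos_cut (f x)" "open_box n B"
    then show "\<exists>B' \<epsilon>. open_box n B' \<and> B' \<subseteq> B \<and> \<epsilon> > 0 \<and> (\<forall>x\<in>B'. \<epsilon> \<in> f x)"
      by (rule definable_fun_bounded_below)
  qed
qed

end
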